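(* Let $1 \le k \le n$ be integers. Let $Q\in\mathbb{M}^{n\times k}$ be uniformly distributed on the Stiefel manifold $\mathbb{V}_k^n$, and let $\Gamma\in\mathbb{M}^{n\times k}$ be a standard Gaussian matrix. Define $$\alpha := \alpha(k,n) := \frac{1}{k}\sum_{i=1}^k \mathbb{E}(X_i),$$ where $X_i \ge 0$ and $X_i^2 \sim \chi^2_{n-i+1}$. Then for each convex function $f : \mathbb{M}^{n\times k}\to\mathbb{R}$, $$\mathbb{E}\, f(Q) \le \mathbb{E}\, f(\alpha^{-1}\Gamma).$$ Similarly, for each concave function $g : \mathbb{M}^{n\times k}\to\mathbb{R}$, $$\mathbb{E}\, g(Q) \ge \mathbb{E}\, g(\alpha^{-1}\Gamma).$$
   Context: $\mathbb{M}^{n\times k}$ is the space of real $n\times k$ matrices. The Stiefel manifold is $\mathbb{V}_k^n := \{Q \in \mathbb{M}^{n\times k} : Q^*Q = \mathrm{I}\}$; "uniformly distributed" means distributed according to the Haar probability measure on $\mathbb{V}_k^n$, invariant under orthogonal transformations on the left and the right. A standard Gaussian matrix has independent $\mathrm{N}(0,1)$ entries. $\chi^2_p$ denotes the chi-square distribution with $p$ degrees of freedom. The expectation $\mathbb{E} f(\alpha^{-1}\Gamma)$ may equal $+\infty$, and $\mathbb{E} g(\alpha^{-1}\Gamma)$ may equal $-\infty$. *)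

theory Defs
  imports "HOL-Probability.Probability"
begin

(* An n x k real matrix has type real^'k^'n: n = CARD('n) rows and k = CARD('k) columns. *)

definition stiefel :: "(real^'k^'n) set" where
  "stiefel = {Q. transpose Q ** Q = mat 1}"

(* The invariant probability measure on the Stiefel manifold, represented as a Borel measure
   on the ambient matrix space that is concentrated on stiefel. *)
definition stiefel_haar :: "(real^'k^'n) measure \<Rightarrow> bool" where
  "stiefel_haar \<mu> \<longleftrightarrow>
     prob_space \<mu> \<and> sets \<mu> = sets borel \<and> (AE Q in \<mu>. Q \<in> stiefel) \<and>
     (\<forall>(U :: real^'n^'n) (V :: real^'k^'k). orthogonal_matrix U \<longrightarrow> orthogonal_matrix V \<longrightarrow>
        distr \<mu> borel (\<lambda>Q. U ** Q ** V) = \<mu>)"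

definition uniform_on_stiefel :: "'a measure \<Rightarrow> ('a \<Rightarrow> real^'k^'n) \<Rightarrow> bool" where
  "uniform_on_stiefel M Q \<longleftrightarrow>
     prob_space M \<and> Q \<in> borel_measurable M \<and> stiefel_haar (distr M borel Q)"

definition standard_gaussian_matrix :: "'a measure \<Rightarrow> ('a \<Rightarrow> real^'k^'n) \<Rightarrow> bool" where
  "standard_gaussian_matrix M \<Gamma> \<longleftrightarrow>
     prob_space M \<and>
     prob_space.indep_vars M (\<lambda>_. borel) (\<lambda>(i, j) \<omega>. \<Gamma> \<omega> $ i $ j) (UNIV :: ('n \<times> 'k) set) \<and>
     (\<forall>i j. distributed M lborel (\<lambda>\<omega>. \<Gamma> \<omega> $ i $ j) std_normal_density)"

(* The law of a sum of squares of p independent N(0,1) variables. *)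
definition chi_square :: "nat \<Rightarrow> real measure" where
  "chi_square p =
     distr (Pi\<^sub>M {..<p} (\<lambda>_. density lborel (\<lambda>x. ennreal (std_normal_density x)))) borel
       (\<lambda>z. \<Sum>i<p. (z i)\<^sup>2)"

(* Expectation with values in [-\<infinity>, \<infinity>].  It is meaningful only under ext_expectation_exists:
   in type ereal the difference \<infinity> - \<infinity> evaluates to \<infinity>.  Note that ennreal maps negative
   reals to 0, so the two integrals are those of the positive and the negative part. *)
definition ext_expectation_exists :: "'a measure \<Rightarrow> ('a \<Rightarrow> real) \<Rightarrow> bool" where
  "ext_expectation_exists M X \<longleftrightarrow>
     X \<in> borel_measurable M \<and>
     ((\<integral>\<^sup>+ \<omega>. ennreal (X \<omega>) \<partial>M) < \<infinity> \<or> (\<integral>\<^sup>+ \<omega>. ennreal (- X \<omega>) \<partial>M) < \<infinity>)"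

definition ext_expectation :: "'a measure \<Rightarrow> ('a \<Rightarrow> real) \<Rightarrow> ereal" where
  "ext_expectation M X =
     enn2ereal (\<integral>\<^sup>+ \<omega>. ennreal (X \<omega>) \<partial>M) - enn2ereal (\<integral>\<^sup>+ \<omega>. ennreal (- X \<omega>) \<partial>M)"

end

theory Submission
  imports Defs
begin

text \<open>
  Let \<open>\<mu>\<close> and \<open>\<gamma>\<close> be the laws of \<open>Q\<close> and \<open>\<Gamma>\<close>. Couple them by the Gibbs kernel
  \<open>K(q, G) = exp (l (G \<bullet> q)) / Z(G)\<close>, where \<open>Z(G)\<close> normalizes the \<open>\<mu>\<close>-integral over \<open>q\<close> to 1.
  As \<open>K\<close>, \<open>\<mu>\<close> and \<open>\<gamma>\<close> are invariant under orthogonal transformations on both sides and \<open>O(n)\<close>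
  is transitive on the Stiefel manifold, the \<open>\<gamma>\<close>-integral of \<open>K(q, \<cdot>)\<close> is 1 as well, and by
  Schur's lemma the conditional mean of \<open>\<Gamma>\<close> given \<open>q\<close> is \<open>\<beta> q\<close> for a constant \<open>\<beta>\<close>. Jensen's
  inequality gives \<open>E f(\<beta> Q) \<le> E f(\<Gamma>)\<close>. As \<open>l\<close> tends to infinity the kernel concentrates on the
  maximizers of \<open>q \<mapsto> G \<bullet> q\<close>, so \<open>k \<beta>\<close> becomes at least \<open>E (sup\<^sub>q \<Gamma> \<bullet> q)\<close> up to an arbitrarily
  small error. Finally \<open>E (sup\<^sub>q \<Gamma> \<bullet> q) \<ge> k \<alpha>\<close>: build an orthonormal frame column by column,
  taking for the \<open>i\<close>-th column the normalized projection of the \<open>i\<close>-th column of \<open>\<Gamma>\<close> onto the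
  orthogonal complement of the previous ones; its length has the law of \<open>X\<^sub>i\<close>.
\<close>

section \<open>Orthogonal matrices\<close>

lemma inner_matrix_mult_left:
  fixes A :: "real^'m^'n" and G :: "real^'k^'m" and H :: "real^'k^'n"
  shows "(A ** G) \<bullet> H = G \<bullet> (transpose A ** H)"
proof -
  have "(A ** G) \<bullet> H = (\<Sum>i\<in>UNIV. \<Sum>j\<in>UNIV. \<Sum>l\<in>UNIV. A$i$l * G$l$j * H$i$j)"
    by (simp add: inner_vec_def matrix_matrix_mult_def sum_distrib_right)
  also have "\<dots> = (\<Sum>i\<in>UNIV. \<Sum>l\<in>UNIV. \<Sum>j\<in>UNIV. A$i$l * G$l$j * H$i$j)"
    by (intro sum.cong refl sum.swap)
  also have "\<dots> = (\<Sum>l\<in>UNIV. \<Sum>i\<in>UNIV. \<Sum>j\<in>UNIV. A$i$l * G$l$j * H$i$j)"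
    by (rule sum.swap)
  also have "\<dots> = (\<Sum>l\<in>UNIV. \<Sum>j\<in>UNIV. \<Sum>i\<in>UNIV. A$i$l * G$l$j * H$i$j)"
    by (intro sum.cong refl sum.swap)
  also have "\<dots> = G \<bullet> (transpose A ** H)"
    by (simp add: inner_vec_def matrix_matrix_mult_def transpose_def sum_distrib_left ac_simps)
  finally show ?thesis .
qed

lemma inner_transpose: "transpose A \<bullet> transpose B = A \<bullet> (B :: real^'k^'n)"
  unfolding inner_vec_def transpose_def by (simp, rule sum.swap)

lemma inner_matrix_mult_right:
  fixes B :: "real^'k^'m" and G :: "real^'m^'n" and H :: "real^'k^'n"
  shows "(G ** B) \<bullet> H = G \<bullet> (H ** transpose B)"
  using inner_matrix_mult_left[of "transpose B" "transpose G" "transpose H"]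
  by (metis inner_transpose matrix_transpose_mul transpose_transpose)

lemma inner_matrix_vector_mult_adjoint:
  fixes A :: "real^'m^'n"
  shows "(A *v x) \<bullet> y = x \<bullet> (transpose A *v y)"
  by (metis dot_lmul_matrix inner_commute transpose_matrix_vector)

lemma orthogonal_matrix_transpose_mult:
  fixes U :: "real^'n^'n"
  assumes "orthogonal_matrix U"
  shows "transpose U ** (U ** G) = G" "U ** (transpose U ** G) = G"
    "H ** U ** transpose U = H" "H ** transpose U ** U = H"
  using assms unfolding orthogonal_matrix_def
  by (metis matrix_mul_assoc matrix_mul_lid matrix_mul_rid)+

lemma linear_matrix_mult:
  "linear (\<lambda>G :: real^'k^'n. (U :: real^'n^'m) ** G ** (V :: real^'l^'k))"
  by (rule linearI)
     (simp_all add: vec_eq_iff matrix_matrix_mult_def sum_distrib_left sum_distrib_right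
       sum.distrib algebra_simps)

lemma borel_measurable_linear:
  fixes f :: "'a::euclidean_space \<Rightarrow> 'b::real_normed_vector"
  shows "linear f \<Longrightarrow> f \<in> borel_measurable borel"
  by (intro borel_measurable_continuous_onI linear_continuous_on)
     (simp add: linear_conv_bounded_linear)

lemma borel_measurable_matrix_mult [measurable]:
  "(\<lambda>G :: real^'k^'n. (U :: real^'n^'n) ** G ** (V :: real^'k^'k)) \<in> borel_measurable borel"
  by (rule borel_measurable_linear[OF linear_matrix_mult])

lemma orthogonal_transformation_orthogonal_matrix_mult:
  fixes U :: "real^'n^'n" and V :: "real^'k^'k"
  assumes "orthogonal_matrix U" "orthogonal_matrix V"
  shows "orthogonal_transformation (\<lambda>G. U ** G ** V)"
  unfolding orthogonal_transformation_def
proof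
  show "linear (\<lambda>G. U ** G ** V)"
    by (rule linear_matrix_mult)
  show "\<forall>v w. (U ** v ** V) \<bullet> (U ** w ** V) = v \<bullet> w"
    by (simp add: inner_matrix_mult_right[of "U ** _"] inner_matrix_mult_left[of U]
        orthogonal_matrix_transpose_mult[OF assms(1)] orthogonal_matrix_transpose_mult[OF assms(2)])
qed

lemma matrix_mult_diff_distrib:
  fixes A B :: "real^'m^'n"
  shows "(A - B) ** C = A ** C - B ** C" "D ** (A - B) = D ** A - D ** B"
  by (simp_all add: vec_eq_iff matrix_matrix_mult_def sum_subtractf algebra_simps)

lemma exists_orthogonal_matrix_mult_eq:
  fixes q q' :: "real^'k^'n"
  assumes gram: "transpose q ** q = transpose q' ** q'"
    and pq: "q ** transpose q ** q = q" and pq': "q' ** transpose q' ** q' = q'"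
  obtains U :: "real^'n^'n" where "orthogonal_matrix U" "U ** q = q'"
proof -
  define S where "S = range ((*v) q)"
  define S' where "S' = range ((*v) q')"
  have subS: "subspace S" "subspace S'"
    by (auto simp: S_def S'_def linear_subspace_image)
  define W where "W = {y. \<forall>x\<in>S. orthogonal x y}"
  define W' where "W' = {y. \<forall>x\<in>S'. orthogonal x y}"
  have subW: "subspace W" "subspace W'"
    by (auto simp: W_def W'_def subspace_orthogonal_to_vectors)
  have W_iff: "y \<in> W \<longleftrightarrow> transpose q *v y = 0" for y
    unfolding W_def S_def orthogonal_def
    by (simp add: inner_matrix_vector_mult_adjoint) (metis inner_eq_zero_iff inner_zero_right)
  have W'_iff: "y \<in> W' \<longleftrightarrow> transpose q' *v y = 0" for y
    unfolding W'_def S'_def orthogonal_def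
    by (simp add: inner_matrix_vector_mult_adjoint) (metis inner_eq_zero_iff inner_zero_right)
  have S'_eq: "S' = (\<lambda>y. (q' ** transpose q) *v y) ` S"
  proof -
    have "(q' ** transpose q) *v (q *v x) = q' *v x" for x
      using gram pq' by (metis matrix_mul_assoc matrix_vector_mul_assoc)
    then show ?thesis unfolding S_def S'_def by (auto simp: image_image)
  qed
  \<comment> \<open>One inequality is enough: it reverses for the complements, and an isometric
    embedding of \<open>W\<close> into \<open>W'\<close> is all that \<open>u\<close>
    requires.\<close>
  have "dim S' \<le> dim S"
    unfolding S'_eq by (rule dim_image_le) (simp_all add: matrix_vector_mul_linear)
  moreover have "dim W + dim S = CARD('n)" "dim W' + dim S' = CARD('n)"
    using dim_subspace_orthogonal_to_vectors[OF subS(1) subspace_UNIV]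
      dim_subspace_orthogonal_to_vectors[OF subS(2) subspace_UNIV]
    by (simp_all add: W_def W'_def)
  ultimately have "dim W \<le> dim W'" by simp
  then obtain F where F: "linear F" "F \<in> W \<rightarrow> W'" "\<And>x. x \<in> W \<Longrightarrow> norm (F x) = norm x"
    using isometry_subset_subspace[OF subW] by blast
  \<comment> \<open>\<open>q ** transpose q\<close> is the orthogonal projection onto
    \<open>S\<close>, so \<open>P\<close> projects onto \<open>W\<close>.\<close>
  define P where "P = mat 1 - q ** transpose q"
  have PW: "P *v x \<in> W" for x
  proof -
    have "transpose q ** q ** transpose q = transpose q"
      by (metis pq matrix_mul_assoc matrix_transpose_mul transpose_transpose)
    then have "transpose q ** P = 0"
      by (simp add: P_def matrix_mult_diff_distrib matrix_mul_assoc)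
    then show ?thesis by (simp add: W_iff matrix_vector_mul_assoc)
  qed
  \<comment> \<open>On \<open>S\<close> this sends \<open>q *v x\<close> to \<open>q' *v x\<close>,
    on \<open>W\<close> it is \<open>F\<close>. The two summands are orthogonal, so Pythagoras gives
    \<open>normu\<close>.\<close>
  define u where "u x = (q' ** transpose q) *v x + F (P *v x)" for x
  have linu: "linear u"
    unfolding u_def
    by (intro linear_compose_add matrix_vector_mul_linear linear_compose[of "(*v) P" F, unfolded o_def] F(1))
  have normu: "norm (u x) = norm x" for x
  proof -
    have FW: "transpose q' *v F (P *v x) = 0"
      using F(2) PW[of x] W'_iff by blast
    have orth: "((q' ** transpose q) *v x) \<bullet> F (P *v x) = 0"
      using FW by (simp add: inner_matrix_vector_mult_adjoint flip: matrix_vector_mul_assoc)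
    have 1: "(norm ((q' ** transpose q) *v x))\<^sup>2 = (norm ((q ** transpose q) *v x))\<^sup>2"
    proof -
      have *: "(A *v y) \<bullet> (A *v y) = y \<bullet> ((transpose A ** A) *v y)" for A :: "real^'k^'n" and y
        by (simp add: inner_matrix_vector_mult_adjoint flip: matrix_vector_mul_assoc)
      show ?thesis
        using *[of q "transpose q *v x"] *[of q' "transpose q *v x"] gram
        by (simp add: power2_norm_eq_inner matrix_vector_mul_assoc[symmetric])
    qed
    have orth2: "((q ** transpose q) *v x) \<bullet> (P *v x) = 0"
      using PW[of x] unfolding W_def S_def orthogonal_def
      by (auto simp: matrix_vector_mul_assoc[symmetric])
    have "(norm (u x))\<^sup>2 = (norm ((q' ** transpose q) *v x))\<^sup>2 + (norm (F (P *v x)))\<^sup>2"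
      unfolding u_def using orth by (intro norm_add_Pythagorean) (simp add: orthogonal_def)
    also have "\<dots> = (norm ((q ** transpose q) *v x))\<^sup>2 + (norm (P *v x))\<^sup>2"
      using 1 F(3)[OF PW] by simp
    also have "\<dots> = (norm ((q ** transpose q) *v x + P *v x))\<^sup>2"
      using orth2 by (intro norm_add_Pythagorean[symmetric]) (simp add: orthogonal_def)
    also have "(q ** transpose q) *v x + P *v x = x"
      by (simp add: P_def matrix_vector_mult_diff_rdistrib)
    finally show ?thesis by simp
  qed
  have orthu: "orthogonal_transformation u"
    using linu normu by (simp add: orthogonal_transformation)
  have "P ** q = 0"
    by (simp add: P_def matrix_mult_diff_distrib pq)
  then have "u (q *v x) = q' *v x" for x
    unfolding u_def using gram pq' linear_0[OF F(1)]
    by (simp add: matrix_vector_mul_assoc) (metis matrix_mul_assoc)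
  then have "matrix u ** q = q'"
    using matrix_works[of u] linu unfolding linear_def scalar_mult_eq_scaleR[abs_def, symmetric]
    by (simp add: matrix_eq flip: matrix_vector_mul_assoc)
  moreover have "orthogonal_matrix (matrix u)"
    using orthu orthogonal_transformation_matrix by blast
  ultimately show thesis using that by blast
qed

section \<open>The standard Gaussian measure\<close>

text \<open>
  The image measure is translation invariant, hence a multiple of Lebesgue measure; the factor is
  1 because the unit ball \<open>B\<close> is preserved. Both facts are extracted from one double integral.
\<close>

lemma distr_lborel_orthogonal_transformation:
  fixes T :: "'a::euclidean_space \<Rightarrow> 'a"
  assumes T: "orthogonal_transformation T"
  shows "distr lborel borel T = lborel"
proof (rule measure_eqI)
  have linT: "linear T" using T by (rule orthogonal_transformation_linear)
  obtain T' where T': "\<And>x. T (T' x) = x"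
    using orthogonal_transformation_surj[OF T] by (metis surjD)
  have [measurable]: "T \<in> borel_measurable borel"
    using linT by (rule borel_measurable_linear)
  have [measurable]: "T' \<in> borel_measurable borel"
  proof -
    have "orthogonal_transformation T'"
      using orthogonal_transformation_inv[OF T] T' 
      by (metis T inv_f_f orthogonal_transformation_inj ext)
    then show ?thesis
      by (intro borel_measurable_linear orthogonal_transformation_linear)
  qed
  have shift: "(\<integral>\<^sup>+x. F (x + a) \<partial>lborel) = (\<integral>\<^sup>+x. F x \<partial>lborel)" 
    if [measurable]: "F \<in> borel_measurable borel" for F :: "'a \<Rightarrow> ennreal" and a
    by (subst lborel_distr_plus[of a, symmetric]) (simp add: nn_integral_distr add.commute)
  have refl: "(\<integral>\<^sup>+x. F (a - x) \<partial>lborel) = (\<integral>\<^sup>+x. F x \<partial>lborel)" 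
    if [measurable]: "F \<in> borel_measurable borel" for F :: "'a \<Rightarrow> ennreal" and a
  proof -
    have "(lborel :: 'a measure) = distr lborel borel (\<lambda>x. a - x)"
      using lborel_affine[of "-1" a] by (simp add: density_1)
    then have "integral\<^sup>N lborel F = integral\<^sup>N (distr lborel borel (\<lambda>x. a - x)) F"
      by (rule arg_cong)
    also have "\<dots> = (\<integral>\<^sup>+x. F (a - x) \<partial>lborel)"
      by (rule nn_integral_distr) simp_all
    finally show ?thesis ..
  qed
  fix A assume "A \<in> sets (distr lborel borel T)"
  then have [measurable]: "A \<in> sets borel" by simp
  define B :: "'a set" where "B = cball 0 1"
  have [measurable]: "B \<in> sets borel" by (simp add: B_def)
  have TB: "indicator B (T x) = (indicator B x :: ennreal)" for x
    using T by (simp add: B_def orthogonal_transformation_norm indicator_def)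
  let ?L = "lborel :: 'a measure"
  \<comment> \<open>Shift \<open>y\<close> by \<open>T x\<close>, exchange the integrals, then shift
    \<open>x\<close> by \<open>- T' y\<close>: the variable \<open>y\<close> moves from
    \<open>B\<close> to \<open>A\<close>. The integral over \<open>y\<close> now sees a reflected
    translate of \<open>A\<close> and yields its Lebesgue measure; the one over \<open>x\<close>
    sees \<open>B\<close>, which \<open>T\<close> preserves.\<close>
  have "(\<integral>\<^sup>+x. indicator A (T x) \<partial>?L) * emeasure ?L B =
    (\<integral>\<^sup>+x. \<integral>\<^sup>+y. indicator A (T x) * indicator B y \<partial>?L \<partial>?L)"
    by (simp add: nn_integral_cmult nn_integral_multc)
  also have "\<dots> = (\<integral>\<^sup>+x. \<integral>\<^sup>+y. indicator A (T x) * indicator B (y + T x) \<partial>?L \<partial>?L)"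
  proof (rule nn_integral_cong)
    fix x
    show "(\<integral>\<^sup>+y. indicator A (T x) * indicator B y \<partial>?L) =
      (\<integral>\<^sup>+y. indicator A (T x) * indicator B (y + T x) \<partial>?L)"
      by (rule shift[of "\<lambda>y. indicator A (T x) * indicator B y" "T x", symmetric]) measurable
  qed
  also have "\<dots> = (\<integral>\<^sup>+y. \<integral>\<^sup>+x. indicator A (T x) * indicator B (y + T x) \<partial>?L \<partial>?L)"
    by (rule lborel_pair.Fubini') measurable
  also have "\<dots> = (\<integral>\<^sup>+y. \<integral>\<^sup>+x. indicator A (T x - y) * indicator B (T x) \<partial>?L \<partial>?L)"
  proof (rule nn_integral_cong)
    fix y
    have *: "T (x - T' y) = T x - y" for x
      using T' by (simp add: linear_diff[OF linT])
    show "(\<integral>\<^sup>+x. indicator A (T x) * indicator B (y + T x) \<partial>?L) =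
      (\<integral>\<^sup>+x. indicator A (T x - y) * indicator B (T x) \<partial>?L)"
      using shift[of "\<lambda>z. indicator A (T z) * indicator B (y + T z)" "- T' y"]
      by (simp add: *)
  qed
  also have "\<dots> = (\<integral>\<^sup>+x. \<integral>\<^sup>+y. indicator A (T x - y) * indicator B (T x) \<partial>?L \<partial>?L)"
    by (rule lborel_pair.Fubini') measurable
  also have "\<dots> = (\<integral>\<^sup>+x. emeasure ?L A * indicator B x \<partial>?L)"
    by (intro nn_integral_cong)
       (simp add: nn_integral_multc refl[of "indicator A"] TB)
  also have "\<dots> = emeasure ?L A * emeasure ?L B"
    by (simp add: nn_integral_cmult)
  finally have "(\<integral>\<^sup>+x. indicator A (T x) \<partial>?L) * emeasure ?L B = emeasure ?L A * emeasure ?L B" .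
  moreover have "emeasure ?L B \<noteq> 0"
    using unit_ball_vol_pos[of "real DIM('a)"] unfolding B_def
    by (subst emeasure_cball) (auto simp: less_le)
  moreover have "emeasure ?L B \<noteq> \<infinity>"
    using emeasure_lborel_cball_finite[of "0::'a" 1] by (simp add: B_def)
  ultimately have "(\<integral>\<^sup>+x. indicator A (T x) \<partial>?L) = emeasure ?L A"
    by (auto simp: ennreal_mult_cancel_left mult.commute[of _ "emeasure ?L B"])
  then show "emeasure (distr lborel borel T) A = emeasure lborel A"
    by (subst nn_integral_indicator[symmetric], simp, subst nn_integral_distr) simp_all
qed simp

text \<open>Defined on every Euclidean space, so that it applies both to matrices and to pairs of
  matrices.\<close>

definition std_gaussian :: "'a::euclidean_space measure" where
  "std_gaussian = density lborel (\<lambda>x. \<Prod>b\<in>Basis. ennreal (std_normal_density (x \<bullet> b)))"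

lemma sets_std_gaussian [measurable_cong, simp]: "sets std_gaussian = sets borel"
  by (simp add: std_gaussian_def)

lemma space_std_gaussian [simp]: "space std_gaussian = UNIV"
  by (simp add: std_gaussian_def)

lemma prod_std_normal_density:
  "(\<Prod>b\<in>Basis. ennreal (std_normal_density (x \<bullet> b))) =
    ennreal ((1 / sqrt (2 * pi)) ^ DIM('a) * exp (- (norm x)\<^sup>2 / 2))" for x :: "'a::euclidean_space"
proof -
  have "(\<Prod>b\<in>Basis. std_normal_density (x \<bullet> b)) =
    (1 / sqrt (2 * pi)) ^ DIM('a) * exp (\<Sum>b\<in>Basis. - (x \<bullet> b)\<^sup>2 / 2)"
    by (simp add: std_normal_density_def prod.distrib exp_sum power_divide prod_dividef)
  also have "(\<Sum>b\<in>Basis. - (x \<bullet> b)\<^sup>2 / 2) = - (norm x)\<^sup>2 / 2"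
    by (simp add: power2_norm_eq_inner euclidean_inner[of x x] power2_eq_square[of "x \<bullet> _"]
        sum_negf flip: sum_divide_distrib)
  finally show ?thesis by (simp add: prod_ennreal)
qed

lemma prob_space_std_gaussian: "prob_space (std_gaussian :: 'a::euclidean_space measure)"
proof
  interpret S: prob_space "density lborel (\<lambda>x. ennreal (std_normal_density x))"
    by (rule prob_space_normal_density) simp
  have "(\<integral>\<^sup>+x. ennreal (std_normal_density x) \<partial>lborel) = 1"
    using S.emeasure_space_1 by (simp add: emeasure_density)
  then show "emeasure std_gaussian (space (std_gaussian :: 'a measure)) = 1"
    using nn_integral_lborel_prod[where 'a='a and f="\<lambda>_ x. ennreal (std_normal_density x)"]
    by (simp add: std_gaussian_def emeasure_density)
qed

text \<open>Lebesgue measure is preserved by \<open>T\<close>, and the density depends on the norm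
  only.\<close>

lemma distr_std_gaussian_orthogonal_transformation:
  fixes T :: "'a::euclidean_space \<Rightarrow> 'a"
  assumes T: "orthogonal_transformation T"
  shows "distr std_gaussian borel T = std_gaussian"
proof (rule measure_eqI)
  have [measurable]: "T \<in> borel_measurable borel"
    by (intro borel_measurable_linear orthogonal_transformation_linear T)
  define D where "D x = (\<Prod>b\<in>Basis. ennreal (std_normal_density (x \<bullet> b)))" for x :: 'a
  have [measurable]: "D \<in> borel_measurable borel" by (simp add: D_def[abs_def])
  have DT: "D (T x) = D x" for x
    by (simp add: D_def prod_std_normal_density orthogonal_transformation_norm[OF T])
  have SD: "std_gaussian = density lborel D" by (simp add: std_gaussian_def D_def[abs_def])
  fix A assume "A \<in> sets (distr (std_gaussian :: 'a measure) borel T)"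
  then have [measurable]: "A \<in> sets borel" by simp
  have "emeasure (distr std_gaussian borel T) A = (\<integral>\<^sup>+x. indicator A (T x) \<partial>std_gaussian)"
    by (subst nn_integral_indicator[symmetric], simp, subst nn_integral_distr) simp_all
  also have "\<dots> = (\<integral>\<^sup>+x. D (T x) * indicator A (T x) \<partial>lborel)"
    unfolding SD by (subst nn_integral_density) (simp_all add: DT)
  also have "\<dots> = (\<integral>\<^sup>+x. D x * indicator A x \<partial>distr lborel borel T)"
    by (subst nn_integral_distr) simp_all
  also have "\<dots> = emeasure std_gaussian A"
    unfolding distr_lborel_orthogonal_transformation[OF T] SD
    by (subst emeasure_density) simp_all
  finally show "emeasure (distr std_gaussian borel T) A = emeasure std_gaussian A" .
qed simp

text \<open>The exponents match because squared norms add up over the components of a pair. Two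
  independent copies thus carry the invariance under all orthogonal maps of the product
  space.\<close>

lemma std_gaussian_pair:
  "std_gaussian \<Otimes>\<^sub>M std_gaussian = (std_gaussian :: ('a::euclidean_space \<times> 'b::euclidean_space) measure)"
proof -
  interpret G: prob_space "std_gaussian :: 'b measure" by (rule prob_space_std_gaussian)
  have "sigma_finite_measure (std_gaussian :: 'b measure)" ..
  then have "std_gaussian \<Otimes>\<^sub>M std_gaussian =
    density (lborel \<Otimes>\<^sub>M lborel) (\<lambda>(x::'a, y::'b). (\<Prod>b\<in>Basis. ennreal (std_normal_density (x \<bullet> b))) *
      (\<Prod>b\<in>Basis. ennreal (std_normal_density (y \<bullet> b))))"
    unfolding std_gaussian_def
    by (intro pair_measure_density) (auto intro: lborel.sigma_finite_measure_axioms)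
  also have "\<dots> = std_gaussian"
    unfolding std_gaussian_def lborel_prod
    by (intro arg_cong2[where f=density] refl ext)
       (auto simp: prod_std_normal_density norm_Pair power_add field_simps simp flip: ennreal_mult exp_add)
  finally show ?thesis .
qed

section \<open>The law of a matrix with independent normal entries\<close>

lemma PiM_density:
  fixes M :: "'i \<Rightarrow> 'a measure"
  assumes I: "finite I"
    and M: "\<And>i. sigma_finite_measure (M i)" and D: "\<And>i. sigma_finite_measure (density (M i) (f i))"
    and f: "\<And>i. f i \<in> borel_measurable (M i)"
  shows "density (PiM I M) (\<lambda>x. \<Prod>i\<in>I. f i (x i)) = PiM I (\<lambda>i. density (M i) (f i))"
proof -
  interpret P: product_sigma_finite M
    using M by (simp add: product_sigma_finite_def)
  interpret D: product_sigma_finite "\<lambda>i. density (M i) (f i)"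
    using D by (simp add: product_sigma_finite_def)
  note f[measurable]
  show ?thesis
  \<comment> \<open>It suffices to compare the measures of boxes, for which the integrand factors
    over the coordinates.\<close>
  proof (rule D.PiM_eqI[OF I])
    show "sets (density (PiM I M) (\<lambda>x. \<Prod>i\<in>I. f i (x i))) = sets (PiM I (\<lambda>i. density (M i) (f i)))"
      by (simp cong: sets_PiM_cong)
    fix A assume A: "\<And>i. i \<in> I \<Longrightarrow> A i \<in> sets (density (M i) (f i))"
    then have [measurable]: "\<And>i. i \<in> I \<Longrightarrow> A i \<in> sets (M i)" by simp
    have [measurable]: "Pi\<^sub>E I A \<in> sets (PiM I M)"
      using I A by (intro sets_PiM_I_finite) auto
    have "emeasure (density (PiM I M) (\<lambda>x. \<Prod>i\<in>I. f i (x i))) (Pi\<^sub>E I A) =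
      (\<integral>\<^sup>+x. (\<Prod>i\<in>I. f i (x i)) * indicator (Pi\<^sub>E I A) x \<partial>PiM I M)"
      by (subst emeasure_density) simp_all
    also have "\<dots> = (\<integral>\<^sup>+x. (\<Prod>i\<in>I. f i (x i) * indicator (A i) (x i)) \<partial>PiM I M)"
    proof (intro nn_integral_cong)
      fix x assume "x \<in> space (PiM I M)"
      then have "indicator (Pi\<^sub>E I A) x = (\<Prod>i\<in>I. indicator (A i) (x i) :: ennreal)"
        using I by (auto simp: indicator_def space_PiM PiE_iff prod_zero_iff)
      then show "(\<Prod>i\<in>I. f i (x i)) * indicator (Pi\<^sub>E I A) x = (\<Prod>i\<in>I. f i (x i) * indicator (A i) (x i))"
        by (simp add: prod.distrib)
    qed
    also have "\<dots> = (\<Prod>i\<in>I. \<integral>\<^sup>+x. f i x * indicator (A i) x \<partial>M i)"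
      by (intro P.product_nn_integral_prod I) simp
    also have "\<dots> = (\<Prod>i\<in>I. emeasure (density (M i) (f i)) (A i))"
      by (intro prod.cong refl) (simp add: emeasure_density)
    finally show "emeasure (density (PiM I M) (\<lambda>x. \<Prod>i\<in>I. f i (x i))) (Pi\<^sub>E I A) =
      (\<Prod>i\<in>I. emeasure (density (M i) (f i)) (A i))" .
  qed
qed

abbreviation "std_normal \<equiv> density lborel (\<lambda>x. ennreal (std_normal_density x))"

lemma prob_space_std_normal: "prob_space std_normal"
  by (rule prob_space_normal_density) simp

text \<open>Lebesgue measure is the image of a product of one-dimensional Lebesgue measures under
  the same map, so only the densities have to be carried along.\<close>

lemma std_gaussian_eq_distr_PiM:
  "(std_gaussian :: 'a::euclidean_space measure) =
    distr (PiM Basis (\<lambda>_. std_normal)) borel (\<lambda>f. \<Sum>b\<in>Basis. f b *\<^sub>R b)"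
proof (rule measure_eqI)
  define D where "D x = (\<Prod>b\<in>Basis. ennreal (std_normal_density (x \<bullet> b)))" for x :: 'a
  have [measurable]: "D \<in> borel_measurable borel" by (simp add: D_def[abs_def])
  have SD: "std_gaussian = density lborel D" by (simp add: std_gaussian_def D_def[abs_def])
  interpret S: prob_space std_normal by (rule prob_space_std_normal)
  have Pi: "PiM (Basis :: 'a set) (\<lambda>_. std_normal) =
    density (PiM Basis (\<lambda>_. lborel)) (\<lambda>f. \<Prod>b\<in>Basis. ennreal (std_normal_density (f b)))"
    by (subst PiM_density)
       (auto intro: lborel.sigma_finite_measure_axioms S.sigma_finite_measure_axioms)
  let ?s = "\<lambda>f. \<Sum>b\<in>(Basis :: 'a set). f b *\<^sub>R b"
  fix A assume "A \<in> sets (std_gaussian :: 'a measure)"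
  then have [measurable]: "A \<in> sets borel" by simp
  have "emeasure (distr (PiM Basis (\<lambda>_. std_normal)) borel ?s) A =
    (\<integral>\<^sup>+f. indicator A (?s f) \<partial>(PiM Basis (\<lambda>_. std_normal)))"
    by (subst nn_integral_indicator[symmetric], simp, subst nn_integral_distr) simp_all
  also have "\<dots> = (\<integral>\<^sup>+f. (\<Prod>b\<in>Basis. ennreal (std_normal_density (f b))) * indicator A (?s f) \<partial>(PiM Basis (\<lambda>_. lborel)))"
    unfolding Pi by (subst nn_integral_density) simp_all
  also have "\<dots> = (\<integral>\<^sup>+f. D (?s f) * indicator A (?s f) \<partial>(PiM Basis (\<lambda>_. lborel)))"
    by (simp add: D_def cong: prod.cong)
  also have "\<dots> = (\<integral>\<^sup>+x. D x * indicator A x \<partial>lborel)"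
    unfolding lborel_eq[where 'a='a] by (subst nn_integral_distr) simp_all
  also have "\<dots> = emeasure std_gaussian A"
    unfolding SD by (subst emeasure_density) simp_all
  finally show "emeasure std_gaussian A = emeasure (distr (PiM Basis (\<lambda>_. std_normal)) borel ?s) A" ..
qed simp

lemma standard_gaussian_matrix_measurable:
  fixes \<Gamma> :: "'b \<Rightarrow> real^'k^'n"
  assumes "standard_gaussian_matrix N \<Gamma>"
  shows "(\<lambda>\<omega>. \<Gamma> \<omega> $ i $ j) \<in> borel_measurable N" "\<Gamma> \<in> borel_measurable N"
proof -
  have *: "(\<lambda>\<omega>. \<Gamma> \<omega> $ i $ j) \<in> borel_measurable N" for i j
    using assms distributed_measurable[of N lborel "\<lambda>\<omega>. \<Gamma> \<omega> $ i $ j" std_normal_density]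
    by (simp add: standard_gaussian_matrix_def)
  then show "(\<lambda>\<omega>. \<Gamma> \<omega> $ i $ j) \<in> borel_measurable N" .
  show "\<Gamma> \<in> borel_measurable N"
    unfolding borel_measurable_euclidean_space[of \<Gamma>]
    using * by (auto simp: Basis_vec_def inner_axis)
qed

text \<open>Independence gives the law of all entries, and an injective choice of positions projects
  it to a smaller product. Used once for all entries, indexed by \<open>Basis\<close>, and once for
  a part of one column.\<close>

lemma standard_gaussian_matrix_joint_law:
  fixes \<Gamma> :: "'b \<Rightarrow> real^'k^'n" and r :: "'i \<Rightarrow> 'n" and c :: "'i \<Rightarrow> 'k"
  assumes \<Gamma>: "standard_gaussian_matrix N \<Gamma>" and inj: "inj_on (\<lambda>i. (r i, c i)) I"
  shows "distr N (PiM I (\<lambda>_. std_normal)) (\<lambda>\<omega>. \<lambda>i\<in>I. \<Gamma> \<omega> $ r i $ c i) = PiM I (\<lambda>_. std_normal)"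
proof -
  interpret prob_space N using \<Gamma> by (simp add: standard_gaussian_matrix_def)
  note [measurable] = standard_gaussian_matrix_measurable[OF \<Gamma>]
  have D: "distr N borel (\<lambda>\<omega>. \<Gamma> \<omega> $ i $ j) = std_normal" for i j
    using \<Gamma> distributed_distr_eq_density[of N lborel "\<lambda>\<omega>. \<Gamma> \<omega> $ i $ j" std_normal_density]
    by (simp add: standard_gaussian_matrix_def cong: distr_cong)
  let ?X = "\<lambda>(i, j) \<omega>. \<Gamma> \<omega> $ i $ j"
  have sets1: "sets (PiM J (\<lambda>_. borel :: real measure)) = sets (PiM J (\<lambda>_. std_normal))" for J :: "'j set"
    by (intro sets_PiM_cong) simp_all
  have "distr N (PiM UNIV (\<lambda>_. borel)) (\<lambda>\<omega>. \<lambda>p\<in>UNIV. ?X p \<omega>) = PiM UNIV (\<lambda>p. distr N borel (?X p))"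
    using \<Gamma> by (subst indep_vars_iff_distr_eq_PiM[symmetric]) 
      (auto simp: standard_gaussian_matrix_def split_beta')
  also have "(\<lambda>p. distr N borel (?X p)) = (\<lambda>_. std_normal)"
    by (auto simp: D)
  finally have U: "distr N (PiM UNIV (\<lambda>_. borel)) (\<lambda>\<omega> p. ?X p \<omega>) = PiM UNIV (\<lambda>_. std_normal)"
    by simp
  have [measurable]: "(\<lambda>\<omega> p. ?X p \<omega>) \<in> measurable N (PiM UNIV (\<lambda>_. borel))"
    by (rule measurable_PiM_single') (auto simp: split_beta')
  have [measurable]: "(\<lambda>z. \<lambda>i\<in>I. z (r i, c i)) \<in> measurable (PiM UNIV (\<lambda>_. borel)) (PiM I (\<lambda>_. std_normal))"
    unfolding measurable_cong_sets[OF refl sets1[symmetric]]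
    by (intro measurable_restrict) simp
  have "PiM I (\<lambda>_. std_normal) =
    distr (PiM UNIV (\<lambda>_. std_normal)) (PiM I (\<lambda>_. std_normal)) (\<lambda>z. \<lambda>i\<in>I. z (r i, c i))"
    using inj prob_space_std_normal
    by (intro distr_PiM_reindex[symmetric, where f="\<lambda>i. (r i, c i)" and M="\<lambda>_. std_normal"]) auto
  also have "\<dots> = distr N (PiM I (\<lambda>_. std_normal)) ((\<lambda>z. \<lambda>i\<in>I. z (r i, c i)) \<circ> (\<lambda>\<omega> p. ?X p \<omega>))"
    unfolding U[symmetric] by (subst distr_distr) simp_all
  finally show ?thesis by (simp add: o_def)
qed

lemma distr_standard_gaussian_matrix:
  fixes \<Gamma> :: "'b \<Rightarrow> real^'k^'n"
  assumes \<Gamma>: "standard_gaussian_matrix N \<Gamma>"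
  shows "distr N borel \<Gamma> = std_gaussian"
proof -
  note [measurable] = standard_gaussian_matrix_measurable[OF \<Gamma>]
  \<comment> \<open>A basis matrix has a single nonzero entry; \<open>r\<close> and \<open>c\<close>
    recover its row and column.\<close>
  define r :: "real^'k^'n \<Rightarrow> 'n" where "r b = (SOME i. \<exists>j. b = axis i (axis j 1))" for b
  define c :: "real^'k^'n \<Rightarrow> 'k" where "c b = (SOME j. b = axis (r b) (axis j 1))" for b
  have rc: "b = axis (r b) (axis (c b) 1)" if "b \<in> Basis" for b
  proof -
    have "\<exists>i j. b = axis i (axis j 1)" using that by (auto simp: Basis_vec_def)
    then have "\<exists>j. b = axis (r b) (axis j 1)" unfolding r_def by (rule someI_ex)
    then show ?thesis unfolding c_def by (rule someI_ex)
  qed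
  have entry: "G $ r b $ c b = G \<bullet> b" if "b \<in> Basis" for b G
    by (subst (3) rc[OF that]) (simp add: inner_axis)
  have inj: "inj_on (\<lambda>b. (r b, c b)) Basis"
    by (rule inj_onI) (metis rc prod.inject)
  have [measurable]: "(\<lambda>\<omega>. \<lambda>b\<in>Basis. \<Gamma> \<omega> $ r b $ c b) \<in> measurable N (PiM Basis (\<lambda>_. std_normal))"
    by (intro measurable_restrict) simp
  have "std_gaussian = distr (distr N (PiM Basis (\<lambda>_. std_normal)) (\<lambda>\<omega>. \<lambda>b\<in>Basis. \<Gamma> \<omega> $ r b $ c b))
      borel (\<lambda>f. \<Sum>b\<in>Basis. f b *\<^sub>R b)"
    unfolding standard_gaussian_matrix_joint_law[OF \<Gamma> inj] by (rule std_gaussian_eq_distr_PiM)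
  also have "\<dots> = distr N borel ((\<lambda>f. \<Sum>b\<in>Basis. f b *\<^sub>R b) \<circ> (\<lambda>\<omega>. \<lambda>b\<in>Basis. \<Gamma> \<omega> $ r b $ c b))"
    by (rule distr_distr) simp_all
  also have "(\<lambda>f. \<Sum>b\<in>Basis. f b *\<^sub>R b) \<circ> (\<lambda>\<omega>. \<lambda>b\<in>Basis. \<Gamma> \<omega> $ r b $ c b) = \<Gamma>"
    by (auto simp: entry euclidean_representation cong: sum.cong)
  finally show ?thesis ..
qed

section \<open>The Stiefel manifold\<close>

text \<open>The squared norm is the trace of \<open>transpose q ** q\<close>. This is the source of
  the factor \<open>CARD('k)\<close> in \<open>barycenter_near_optimal\<close>.\<close>

lemma inner_stiefel_self:
  fixes q :: "real^'k^'n"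
  assumes "q \<in> stiefel"
  shows "q \<bullet> q = CARD('k)"
proof -
  have "q \<bullet> q = mat 1 \<bullet> (transpose q ** q)"
    using inner_matrix_mult_left[of q "mat 1" q] by simp
  also have "\<dots> = (mat 1 :: real^'k^'k) \<bullet> mat 1"
    using assms by (simp add: stiefel_def)
  also have "\<dots> = CARD('k)"
    by (simp add: inner_vec_def mat_def if_distrib[of "\<lambda>x. x * _"] cong: if_cong)
  finally show ?thesis .
qed

lemma norm_stiefel: "q \<in> stiefel \<Longrightarrow> norm (q :: real^'k^'n) = sqrt CARD('k)"
  by (simp add: norm_eq_sqrt_inner inner_stiefel_self)

lemma abs_inner_stiefel_le:
  fixes q G :: "real^'k^'n"
  assumes "q \<in> stiefel"
  shows "\<bar>G \<bullet> q\<bar> \<le> sqrt CARD('k) * norm G"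
  using Cauchy_Schwarz_ineq2[of G q] norm_stiefel[OF assms] by (simp add: mult.commute)

lemma transpose_add: "transpose (A + B) = transpose A + transpose (B :: real^'k^'n)"
  and transpose_diff: "transpose (A - B) = transpose A - transpose (B :: real^'k^'n)"
  by (simp_all add: transpose_def vec_eq_iff)

lemma orthogonal_matrix_mat_1: "orthogonal_matrix (mat 1 :: real^'n^'n)"
  by (simp add: orthogonal_matrix_def transpose_mat)

lemma stiefel_transitive:
  fixes q q' :: "real^'k^'n"
  assumes "q \<in> stiefel" "q' \<in> stiefel"
  obtains U :: "real^'n^'n" where "orthogonal_matrix U" "U ** q = q'"
proof (rule exists_orthogonal_matrix_mult_eq[of q q'])
  show "transpose q ** q = transpose q' ** q'" using assms by (simp add: stiefel_def)
  show "q ** transpose q ** q = q" "q' ** transpose q' ** q' = q'"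
    using assms by (simp_all add: stiefel_def flip: matrix_mul_assoc)
qed (use that in auto)

lemma inner_orthogonal_mult:
  fixes G H :: "real^'k^'n"
  assumes "orthogonal_matrix U" "orthogonal_matrix V"
  shows "(U ** G ** V) \<bullet> (U ** H ** V) = G \<bullet> H"
  using orthogonal_transformation_orthogonal_matrix_mult[OF assms]
  by (simp add: orthogonal_transformation_def)

text \<open>Signed permutation matrices, applied to involutions \<open>p\<close> only: then
  \<open>p\<close> is its own inverse and the entries of products have simple formulas. Sign changes
  and transpositions are all that Schur's lemma needs.\<close>

definition signed_involution :: "('k \<Rightarrow> 'k) \<Rightarrow> ('k \<Rightarrow> real) \<Rightarrow> real^'k^'k" where
  "signed_involution p s = (\<chi> i j. if i = p j then s j else 0)"

lemma orthogonal_signed_involution: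
  assumes p: "\<And>i. p (p i) = i" and s: "\<And>i. s i * s i = 1"
  shows "orthogonal_matrix (signed_involution p s)"
proof -
  have "(\<Sum>l\<in>UNIV. (if l = p i then s i else 0) * (if l = p j then s j else 0)) = (if i = j then 1 else 0)" for i j
  proof -
    have "(\<Sum>l\<in>UNIV. (if l = p i then s i else 0) * (if l = p j then s j else 0)) =
      (\<Sum>l\<in>UNIV. if l = p i then s i * (if p i = p j then s j else 0) else 0)"
      by (intro sum.cong) auto
    also have "\<dots> = s i * (if p i = p j then s j else 0)" by simp
    also have "\<dots> = (if i = j then 1 else 0)"
    proof -
      have "p i = p j \<longleftrightarrow> i = j" using p by metis
      then show ?thesis by (simp add: s)
    qed
    finally show ?thesis .
  qed
  then show ?thesis
    by (simp add: orthogonal_matrix vec_eq_iff matrix_matrix_mult_def transpose_def mat_def signed_involution_def)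
qed

lemma signed_involution_mult:
  assumes p: "\<And>i. p (p i) = i"
  shows "(signed_involution p s ** B) $ a $ b = s (p a) * B $ p a $ b"
    and "(B ** signed_involution p s) $ a $ b = B $ a $ p b * s b"
proof -
  have *: "a = p l \<longleftrightarrow> l = p a" for l using p by metis
  have "(\<Sum>l\<in>UNIV. (if a = p l then s l else 0) * B $ l $ b) =
    (\<Sum>l\<in>UNIV. if l = p a then s l * B $ l $ b else 0)"
    unfolding * by (intro sum.cong) auto
  then show "(signed_involution p s ** B) $ a $ b = s (p a) * B $ p a $ b"
    by (simp add: matrix_matrix_mult_def signed_involution_def)
  have "(\<Sum>l\<in>UNIV. B $ a $ l * (if l = p b then s b else 0)) =
    (\<Sum>l\<in>UNIV. if l = p b then B $ a $ l * s b else 0)"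
    by (intro sum.cong) auto
  then show "(B ** signed_involution p s) $ a $ b = B $ a $ p b * s b"
    by (simp add: matrix_matrix_mult_def signed_involution_def)
qed

text \<open>Schur's lemma for the stabilizer of \<open>q\<close> in \<open>O(n) \<times> O(k)\<close>.\<close>

lemma scalar_of_stabilizer_invariant:
  fixes q A :: "real^'k^'n"
  assumes q: "q \<in> stiefel"
    and inv: "\<And>U V. orthogonal_matrix U \<Longrightarrow> orthogonal_matrix V \<Longrightarrow> U ** q ** V = q \<Longrightarrow> U ** A ** V = A"
  obtains \<beta> where "A = \<beta> *\<^sub>R q"
proof -
  have qq: "transpose q ** q = mat 1" using q by (simp add: stiefel_def)
  define P where "P = mat 1 - q ** transpose q"
  have Pq: "P ** q = 0" and qP: "transpose q ** P = 0" and PT: "transpose P = P"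
    unfolding P_def
    by (simp_all add: matrix_mult_diff_distrib matrix_mul_assoc qq transpose_diff matrix_transpose_mul transpose_mat)
       (simp_all add: qq flip: matrix_mul_assoc)
  have PP: "P ** P = P"
    by (subst (2) P_def) (simp add: matrix_mult_diff_distrib matrix_mul_assoc Pq)
  \<comment> \<open>In the coordinates given by \<open>q\<close> this acts as
    \<open>transpose V\<close> on the range of \<open>q\<close>, and it is the identity on the
    complement; hence the pair of \<open>U V\<close> and \<open>V\<close> stabilizes
    \<open>q\<close>.\<close>
  define U where "U V = q ** transpose V ** transpose q + P" for V :: "real^'k^'k"
  have add_distrib: "(X + Y) ** Z = X ** Z + Y ** Z" for X Y :: "real^'m^'l" and Z :: "real^'p^'m"
    by (simp add: vec_eq_iff matrix_matrix_mult_def sum.distrib algebra_simps)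
  have U: "orthogonal_matrix (U V)" "U V ** q ** V = q" if V: "orthogonal_matrix V" for V
  proof -
    have "transpose (U V) = q ** V ** transpose q + P"
      by (simp add: U_def PT transpose_add matrix_transpose_mul matrix_mul_assoc)
    then have "transpose (U V) ** U V = q ** V ** (transpose q ** q) ** transpose V ** transpose q +
       q ** V ** (transpose q ** P) + (P ** q) ** transpose V ** transpose q + P ** P"
      by (simp add: U_def add_distrib matrix_add_ldistrib matrix_mul_assoc)
    also have "\<dots> = q ** (V ** transpose V) ** transpose q + P"
      by (simp add: qq Pq qP PP matrix_mul_assoc)
    also have "\<dots> = mat 1"
      using V by (simp add: orthogonal_matrix_def P_def)
    finally show "orthogonal_matrix (U V)" by (simp add: orthogonal_matrix)
    have "U V ** q ** V = q ** transpose V ** (transpose q ** q) ** V + P ** q ** V"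
      by (simp add: U_def add_distrib matrix_mul_assoc)
    also have "\<dots> = q ** (transpose V ** V)"
      by (simp add: qq Pq matrix_mul_assoc)
    finally show "U V ** q ** V = q" using V by (simp add: orthogonal_matrix_def)
  qed
  define B where "B = transpose q ** A"
  have qB: "q ** B = A"
  proof -
    \<comment> \<open>The reflection that fixes the range of \<open>q\<close> and negates its
      complement. Invariance of \<open>A\<close> under it kills the component
      \<open>P ** A\<close>.\<close>
    define R where "R = q ** transpose q - P"
    have RT: "transpose R = R"
      by (simp add: R_def PT transpose_diff matrix_transpose_mul)
    have "R ** R = q ** (transpose q ** q) ** transpose q - q ** (transpose q ** P)
        - ((P ** q) ** transpose q - P ** P)"
      by (simp add: R_def matrix_mult_diff_distrib matrix_mul_assoc)
    also have "\<dots> = q ** transpose q + P" by (simp add: qq Pq qP PP)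
    also have "\<dots> = mat 1" by (simp add: P_def)
    finally have "orthogonal_matrix R" by (simp add: orthogonal_matrix RT)
    moreover have "R ** q ** mat 1 = q"
      by (simp add: R_def matrix_mult_diff_distrib Pq qq flip: matrix_mul_assoc)
    ultimately have "R ** A ** mat 1 = A"
      using orthogonal_matrix_mat_1 inv by blast
    then have "R ** A = A" by simp
    moreover have "R ** A + P ** A = q ** B"
      by (simp add: R_def B_def matrix_mult_diff_distrib matrix_mul_assoc)
    moreover have "q ** B + P ** A = A"
      by (simp add: P_def B_def matrix_mult_diff_distrib matrix_mul_assoc)
    ultimately show ?thesis by (simp add: vec_eq_iff) (smt (verit))
  qed
  have comm: "V ** B = B ** V" if V: "orthogonal_matrix V" for V
  proof -
    \<comment> \<open>In the coordinates given by \<open>q\<close>, the stabilizer acts on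
      \<open>B\<close> by conjugation with \<open>V\<close>.\<close>
    have "U V ** A ** V = A" using U[OF V] inv V by blast
    then have "B = transpose q ** (U V ** A ** V)" by (simp add: B_def)
    also have "\<dots> = (transpose q ** q) ** transpose V ** (transpose q ** A) ** V + (transpose q ** P) ** A ** V"
      by (simp add: U_def add_distrib matrix_add_ldistrib matrix_mul_assoc)
    also have "\<dots> = transpose V ** B ** V" by (simp add: qq qP B_def)
    finally have "V ** B = V ** (transpose V ** (B ** V))" by (simp add: matrix_mul_assoc)
    then show ?thesis by (simp add: orthogonal_matrix_transpose_mult[OF V])
  qed
  have entries: "s (p a) * B $ p a $ b = B $ a $ p b * s b"
    if "\<And>i. p (p i) = i" "\<And>i. s i * s i = 1" for p s a b
    using arg_cong[OF comm[OF orthogonal_signed_involution[OF that]], of "\<lambda>X. X $ a $ b"]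
    by (simp add: signed_involution_mult[OF that(1)])
  \<comment> \<open>Commuting with one sign change annihilates the entries off the diagonal;
    commuting with a transposition equates two diagonal entries.\<close>
  have offdiag: "B $ a $ b = 0" if "a \<noteq> b" for a b
    using entries[of id "\<lambda>i. if i = a then - 1 else 1" a b] that by simp
  have diag: "B $ a $ a = B $ b $ b" for a b
    using entries[of "Transposition.transpose a b" "\<lambda>_. 1" a b] by simp
  obtain a :: 'k where True by simp
  have "B = (B $ a $ a) *\<^sub>R mat 1"
    using offdiag by (auto simp: vec_eq_iff mat_def intro: diag)
  moreover have "q ** (c *\<^sub>R mat 1) = c *\<^sub>R q" for c :: real
  proof -
    have "(\<Sum>l\<in>UNIV. q $ i $ l * (c * (if l = j then 1 else 0))) = (\<Sum>l\<in>UNIV. if l = j then q $ i $ l * c else 0)" for i j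
      by (intro sum.cong) auto
    then show ?thesis by (simp add: vec_eq_iff matrix_matrix_mult_def mat_def mult.commute)
  qed
  ultimately have "A = (B $ a $ a) *\<^sub>R q"
    using qB by metis
  then show thesis by (rule that)
qed

section \<open>The Gibbs coupling\<close>

text \<open>The coupling argument sees \<open>\<gamma>\<close> only through its two-sided orthogonal
  invariance and its first moment. Gaussianity enters later, in the lower bound for the mean of
  \<open>sup_inner stiefel\<close>.\<close>

locale haar_and_invariant =
  fixes \<mu> \<gamma> :: "(real^'k^'n) measure"
  assumes haar: "stiefel_haar \<mu>"
    and prob_gamma: "prob_space \<gamma>"
    and sets_gamma [measurable_cong, simp]: "sets \<gamma> = sets borel"
    and gamma_invariant: "\<And>U V. orthogonal_matrix U \<Longrightarrow> orthogonal_matrix V \<Longrightarrow>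
      distr \<gamma> borel (\<lambda>G. U ** G ** V) = \<gamma>"
    and integrable_norm: "integrable \<gamma> norm"
begin

sublocale H: prob_space \<mu> using haar by (simp add: stiefel_haar_def)
sublocale G: prob_space \<gamma> by (rule prob_gamma)
sublocale pair_prob_space \<mu> \<gamma> ..

lemma sets_haar [measurable_cong, simp]: "sets \<mu> = sets borel"
  using haar by (simp add: stiefel_haar_def)

lemma space_haar [simp]: "space \<mu> = UNIV" and space_gamma [simp]: "space \<gamma> = UNIV"
  using sets_eq_imp_space_eq[OF sets_haar] sets_eq_imp_space_eq[OF sets_gamma] by simp_all

lemma emeasure_UNIV [simp]: "emeasure \<mu> UNIV = 1" "emeasure \<gamma> UNIV = 1"
  using H.emeasure_space_1 G.emeasure_space_1 by simp_all

lemma measure_UNIV [simp]: "measure \<mu> UNIV = 1" "measure \<gamma> UNIV = 1"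
  by (simp_all add: measure_def)

lemma AE_stiefel: "AE q in \<mu>. q \<in> stiefel"
  using haar by (simp add: stiefel_haar_def)

lemma haar_invariant:
  "orthogonal_matrix U \<Longrightarrow> orthogonal_matrix V \<Longrightarrow> distr \<mu> borel (\<lambda>q. U ** q ** V) = \<mu>"
  using haar by (simp add: stiefel_haar_def)

definition normalizer :: "real \<Rightarrow> real^'k^'n \<Rightarrow> real" where
  "normalizer l G = (\<integral>q. exp (l * (G \<bullet> q)) \<partial>\<mu>)"

definition gibbs :: "real \<Rightarrow> real^'k^'n \<Rightarrow> real^'k^'n \<Rightarrow> real" where
  "gibbs l q G = exp (l * (G \<bullet> q)) / normalizer l G"

lemma measurable_normalizer [measurable]: "normalizer l \<in> borel_measurable borel"
  unfolding normalizer_def by measurable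

lemma measurable_gibbs [measurable]:
  assumes [measurable]: "f \<in> borel_measurable M" "g \<in> borel_measurable M"
  shows "(\<lambda>x. gibbs l (f x) (g x)) \<in> borel_measurable M"
  unfolding gibbs_def by measurable

lemma exp_inner_bounds:
  fixes q G :: "real^'k^'n"
  assumes "q \<in> stiefel"
  shows "exp (l * (G \<bullet> q)) \<le> exp (\<bar>l\<bar> * (sqrt CARD('k) * norm G))"
    "exp (- \<bar>l\<bar> * (sqrt CARD('k) * norm G)) \<le> exp (l * (G \<bullet> q))"
proof -
  have "\<bar>l * (G \<bullet> q)\<bar> \<le> \<bar>l\<bar> * (sqrt CARD('k) * norm G)"
    unfolding abs_mult by (intro mult_left_mono abs_inner_stiefel_le assms) simp
  then show "exp (l * (G \<bullet> q)) \<le> exp (\<bar>l\<bar> * (sqrt CARD('k) * norm G))"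
    "exp (- \<bar>l\<bar> * (sqrt CARD('k) * norm G)) \<le> exp (l * (G \<bullet> q))"
    by auto
qed

lemma integrable_exp_inner: "integrable \<mu> (\<lambda>q. exp (l * (G \<bullet> q)))"
proof (rule H.integrable_const_bound)
  show "AE q in \<mu>. norm (exp (l * (G \<bullet> q))) \<le> exp (\<bar>l\<bar> * (sqrt CARD('k) * norm G))"
    using AE_stiefel by eventually_elim (use exp_inner_bounds(1) in auto)
qed simp

lemma normalizer_pos: "0 < normalizer l G"
proof -
  have "exp (- \<bar>l\<bar> * (sqrt CARD('k) * norm G)) \<le> normalizer l G"
    unfolding normalizer_def
  proof (rule H.integral_ge_const[OF integrable_exp_inner])
    show "AE q in \<mu>. exp (- \<bar>l\<bar> * (sqrt CARD('k) * norm G)) \<le> exp (l * (G \<bullet> q))"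
      using AE_stiefel by eventually_elim (rule exp_inner_bounds(2))
  qed
  then show ?thesis using exp_gt_zero less_le_trans by blast
qed

lemma gibbs_nonneg: "0 \<le> gibbs l q G"
  using normalizer_pos[of l G] by (simp add: gibbs_def)

lemma normalizer_invariant:
  assumes "orthogonal_matrix U" "orthogonal_matrix V"
  shows "normalizer l (U ** G ** V) = normalizer l G"
proof -
  have "normalizer l (U ** G ** V) = (\<integral>q. exp (l * ((U ** G ** V) \<bullet> q)) \<partial>distr \<mu> borel (\<lambda>q. U ** q ** V))"
    by (simp add: normalizer_def haar_invariant[OF assms])
  also have "\<dots> = (\<integral>q. exp (l * ((U ** G ** V) \<bullet> (U ** q ** V))) \<partial>\<mu>)"
    by (rule integral_distr) simp_all
  finally show ?thesis by (simp add: inner_orthogonal_mult[OF assms] normalizer_def)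
qed

lemma gibbs_invariant:
  assumes "orthogonal_matrix U" "orthogonal_matrix V"
  shows "gibbs l (U ** q ** V) (U ** G ** V) = gibbs l q G"
  by (simp add: gibbs_def normalizer_invariant[OF assms] inner_orthogonal_mult[OF assms])

lemma integrable_gibbs_haar: "integrable \<mu> (\<lambda>q. gibbs l q G)"
  unfolding gibbs_def by (simp add: integrable_exp_inner)

lemma integral_gibbs_haar: "(\<integral>q. gibbs l q G \<partial>\<mu>) = 1"
  unfolding gibbs_def using normalizer_pos[of l G] by (simp add: normalizer_def[symmetric])

lemma nn_integral_gibbs_haar: "(\<integral>\<^sup>+q. gibbs l q G \<partial>\<mu>) = 1"
  by (simp add: nn_integral_eq_integral integrable_gibbs_haar gibbs_nonneg integral_gibbs_haar)

text \<open>Tonelli: the kernel has mass 1 in \<open>q\<close> for each \<open>G\<close>. So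
  \<open>\<gamma>\<close> is the law of the second component of the coupling.\<close>

lemma nn_integral_gibbs_pair:
  assumes [measurable]: "h \<in> borel_measurable borel"
  shows "(\<integral>\<^sup>+q. \<integral>\<^sup>+G. ennreal (gibbs l q G) * h G \<partial>\<gamma> \<partial>\<mu>) = (\<integral>\<^sup>+G. h G \<partial>\<gamma>)"
proof -
  have "(\<integral>\<^sup>+q. \<integral>\<^sup>+G. ennreal (gibbs l q G) * h G \<partial>\<gamma> \<partial>\<mu>) =
    (\<integral>\<^sup>+G. \<integral>\<^sup>+q. ennreal (gibbs l q G) * h G \<partial>\<mu> \<partial>\<gamma>)"
    by (rule Fubini'[symmetric]) measurable
  also have "\<dots> = (\<integral>\<^sup>+G. h G \<partial>\<gamma>)"
    by (simp add: nn_integral_multc nn_integral_gibbs_haar)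
  finally show ?thesis .
qed

text \<open>The left-hand side is left-invariant in \<open>q\<close>, hence constant on the Stiefel manifold.\<close>

lemma nn_integral_gibbs_gamma:
  assumes [measurable]: "h \<in> borel_measurable borel"
    and h: "\<And>U G. orthogonal_matrix U \<Longrightarrow> h (U ** G) = h G"
    and q: "q \<in> stiefel"
  shows "(\<integral>\<^sup>+G. ennreal (gibbs l q G) * h G \<partial>\<gamma>) = (\<integral>\<^sup>+G. h G \<partial>\<gamma>)"
proof -
  define c where "c q = (\<integral>\<^sup>+G. ennreal (gibbs l q G) * h G \<partial>\<gamma>)" for q
  have "c q' = c q" if q': "q' \<in> stiefel" for q'
  proof -
    obtain U where U: "orthogonal_matrix U" "U ** q = q'" using stiefel_transitive[OF q q'] .
    have "c q' = (\<integral>\<^sup>+G. ennreal (gibbs l q' G) * h G \<partial>distr \<gamma> borel (\<lambda>G. U ** G ** mat 1))"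
      by (simp only: c_def gamma_invariant[OF U(1) orthogonal_matrix_mat_1])
    also have "\<dots> = (\<integral>\<^sup>+G. ennreal (gibbs l q' (U ** G ** mat 1)) * h (U ** G ** mat 1) \<partial>\<gamma>)"
      by (subst nn_integral_distr) measurable
    also have "\<dots> = c q"
      using gibbs_invariant[OF U(1) orthogonal_matrix_mat_1, of l q] by (simp add: U c_def h)
    finally show ?thesis .
  qed
  then have "(\<integral>\<^sup>+q'. c q' \<partial>\<mu>) = (\<integral>\<^sup>+q'. c q \<partial>\<mu>)"
    using AE_stiefel by (intro nn_integral_cong_AE) auto
  also have "\<dots> = c q" by simp
  finally show ?thesis using nn_integral_gibbs_pair[of h l] by (simp add: c_def)
qed

text \<open>The case \<open>h = 1\<close> says that the kernel has mass 1 in \<open>G\<close> too,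
  so the first component of the coupling has law \<open>\<mu>\<close>.\<close>

lemma integrable_gibbs_gamma: "q \<in> stiefel \<Longrightarrow> integrable \<gamma> (\<lambda>G. gibbs l q G)"
  using nn_integral_gibbs_gamma[of "\<lambda>_. 1" q l]
  by (intro integrableI_bounded) (simp_all add: gibbs_nonneg)

lemma integral_gibbs_gamma: "q \<in> stiefel \<Longrightarrow> (\<integral>G. gibbs l q G \<partial>\<gamma>) = 1"
  using nn_integral_gibbs_gamma[of "\<lambda>_. 1" q l] gibbs_nonneg
  by (simp add: integral_eq_nn_integral)

lemma integrable_gibbs_scaleR:
  assumes q: "q \<in> stiefel"
  shows "integrable \<gamma> (\<lambda>G. gibbs l q G *\<^sub>R G)"
proof (rule integrableI_bounded)
  have "norm (U ** G) = norm G" if "orthogonal_matrix U" for U :: "real^'n^'n" and G :: "real^'k^'n"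
    using inner_orthogonal_mult[OF that orthogonal_matrix_mat_1, of G G] by (simp add: norm_eq_sqrt_inner)
  then have "(\<integral>\<^sup>+G. ennreal (gibbs l q G) * ennreal (norm G) \<partial>\<gamma>) = (\<integral>\<^sup>+G. ennreal (norm G) \<partial>\<gamma>)"
    by (intro nn_integral_gibbs_gamma q) auto
  also have "\<dots> < \<infinity>"
    using integrable_norm by (simp add: integrable_iff_bounded)
  finally show "(\<integral>\<^sup>+G. ennreal (norm (gibbs l q G *\<^sub>R G)) \<partial>\<gamma>) < \<infinity>"
    by (simp add: gibbs_nonneg ennreal_mult)
qed measurable

text \<open>The conditional mean of the second component of the coupling, given that the first is
  \<open>q\<close>.\<close>

definition barycenter :: "real \<Rightarrow> real^'k^'n \<Rightarrow> real^'k^'n" where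
  "barycenter l q = (\<integral>G. gibbs l q G *\<^sub>R G \<partial>\<gamma>)"

lemma barycenter_equivariant:
  assumes U: "orthogonal_matrix U" and V: "orthogonal_matrix V" and q: "q \<in> stiefel"
  shows "barycenter l (U ** q ** V) = U ** barycenter l q ** V"
proof -
  have bl: "bounded_linear (\<lambda>G :: real^'k^'n. U ** G ** V)"
    using linear_matrix_mult by (simp add: linear_conv_bounded_linear)
  have "barycenter l (U ** q ** V) =
    (\<integral>G. gibbs l (U ** q ** V) G *\<^sub>R G \<partial>distr \<gamma> borel (\<lambda>G. U ** G ** V))"
    by (simp only: barycenter_def gamma_invariant[OF U V])
  also have "\<dots> = (\<integral>G. gibbs l q G *\<^sub>R (U ** G ** V) \<partial>\<gamma>)"
    by (subst integral_distr) (simp_all add: gibbs_invariant[OF U V])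
  also have "\<dots> = (\<integral>G. U ** (gibbs l q G *\<^sub>R G) ** V \<partial>\<gamma>)"
    by (simp add: linear_scale[OF bounded_linear.linear[OF bl]])
  also have "\<dots> = U ** barycenter l q ** V"
    unfolding barycenter_def by (rule integral_bounded_linear[OF bl integrable_gibbs_scaleR[OF q]])
  finally show ?thesis .
qed

text \<open>By equivariance the value at \<open>q0\<close> is fixed by the stabilizer of
  \<open>q0\<close>, so Schur's lemma makes it a multiple of \<open>q0\<close>. Transitivity carries
  the same factor to every other point.\<close>

lemma barycenter_scalar:
  obtains \<beta> where "\<And>q. q \<in> stiefel \<Longrightarrow> barycenter l q = \<beta> *\<^sub>R q"
proof (cases "\<exists>q :: real^'k^'n. q \<in> stiefel")
  case True
  then obtain q0 :: "real^'k^'n" where q0: "q0 \<in> stiefel" by blast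
  obtain \<beta> where \<beta>: "barycenter l q0 = \<beta> *\<^sub>R q0"
    using scalar_of_stabilizer_invariant[OF q0, of "barycenter l q0"] barycenter_equivariant[OF _ _ q0]
    by metis
  have "barycenter l q = \<beta> *\<^sub>R q" if q: "q \<in> stiefel" for q :: "real^'k^'n"
  proof -
    obtain U where U: "orthogonal_matrix U" "U ** q0 = q" using stiefel_transitive[OF q0 q] .
    have "barycenter l q = U ** (\<beta> *\<^sub>R q0)"
      using barycenter_equivariant[OF U(1) orthogonal_matrix_mat_1 q0] \<beta> U by simp
    also have "\<dots> = \<beta> *\<^sub>R (U ** q0)"
      by (simp add: vec_eq_iff matrix_matrix_mult_def sum_distrib_left mult_ac)
    finally show ?thesis using U by simp
  qed
  then show thesis by (rule that)
qed (use that in auto)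

text \<open>The bound \<open>h\<close> depends on \<open>G\<close> alone, so integrating over
  \<open>q\<close> removes the kernel. It is needed only where \<open>\<mu>\<close> is
  concentrated.\<close>

lemma integrable_gibbs_pair:
  assumes [measurable]: "w \<in> borel_measurable (borel \<Otimes>\<^sub>M borel)" and h: "integrable \<gamma> h"
    and le: "\<And>q G. q \<in> stiefel \<Longrightarrow> \<bar>w (q, G)\<bar> \<le> h G"
  shows "integrable (\<mu> \<Otimes>\<^sub>M \<gamma>) (\<lambda>(q, G). gibbs l q G * w (q, G))"
proof (rule integrableI_bounded)
  have [measurable]: "h \<in> borel_measurable borel" using h by simp
  have "(\<integral>\<^sup>+x. ennreal (norm (case x of (q, G) \<Rightarrow> gibbs l q G * w (q, G))) \<partial>(\<mu> \<Otimes>\<^sub>M \<gamma>)) =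
    (\<integral>\<^sup>+q. \<integral>\<^sup>+G. ennreal (norm (gibbs l q G * w (q, G))) \<partial>\<gamma> \<partial>\<mu>)"
    by (subst G.nn_integral_fst[symmetric]) (auto simp: case_prod_beta)
  also have "\<dots> \<le> (\<integral>\<^sup>+q. \<integral>\<^sup>+G. ennreal (gibbs l q G) * ennreal (h G) \<partial>\<gamma> \<partial>\<mu>)"
  proof (rule nn_integral_mono_AE, rule AE_mp[OF AE_stiefel], rule AE_I2, rule impI, rule nn_integral_mono)
    fix q G :: "real^'k^'n" assume "q \<in> stiefel"
    then show "ennreal (norm (gibbs l q G * w (q, G))) \<le> ennreal (gibbs l q G) * ennreal (h G)"
      using le[of q G] by (simp add: abs_mult gibbs_nonneg mult_left_mono flip: ennreal_mult')
  qed
  also have "\<dots> = (\<integral>\<^sup>+G. ennreal (h G) \<partial>\<gamma>)"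
    by (rule nn_integral_gibbs_pair) simp
  also have "\<dots> \<le> (\<integral>\<^sup>+G. ennreal (norm (h G)) \<partial>\<gamma>)"
    by (intro nn_integral_mono ennreal_leI) simp
  also have "\<dots> < \<infinity>" using h by (simp add: integrable_iff_bounded)
  finally show "(\<integral>\<^sup>+x. ennreal (norm (case x of (q, G) \<Rightarrow> gibbs l q G * w (q, G))) \<partial>(\<mu> \<Otimes>\<^sub>M \<gamma>)) < \<infinity>" .
qed (simp add: case_prod_beta)

end

section \<open>Convex functions\<close>

text \<open>A hyperplane separates the point \<open>(a, f a)\<close> from the strict epigraph of
  \<open>f\<close>; it is not vertical, so it is the graph of an affine minorant touching
  \<open>f\<close> at \<open>a\<close>.\<close>

lemma convex_on_UNIV_subgradient:
  fixes f :: "'a::euclidean_space \<Rightarrow> real"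
  assumes f: "convex_on UNIV f"
  obtains s where "\<And>x. f a + s \<bullet> (x - a) \<le> f x"
proof -
  define T where "T = {(x, y). f x < y}"
  have "convex T"
  proof (rule convexI)
    fix z w and u v :: real assume zw: "z \<in> T" "w \<in> T" and uv: "0 \<le> u" "0 \<le> v" "u + v = 1"
    have "f (u *\<^sub>R fst z + v *\<^sub>R fst w) \<le> u * f (fst z) + v * f (fst w)"
      using f uv by (simp add: convex_on_def)
    also have "\<dots> < u * snd z + v * snd w"
    proof (cases "u = 0")
      case True
      then show ?thesis using zw uv by (auto simp: T_def)
    next
      case False
      then have "u * f (fst z) < u * snd z" using zw uv by (auto simp: T_def)
      moreover have "v * f (fst w) \<le> v * snd w" using zw uv by (auto simp: T_def intro: mult_left_mono)
      ultimately show ?thesis by simp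
    qed
    finally show "u *\<^sub>R z + v *\<^sub>R w \<in> T" by (simp add: T_def case_prod_beta)
  qed
  moreover have "(a, f a + 1) \<in> T" by (simp add: T_def)
  then have "T \<noteq> {}" by blast
  moreover have "{(a, f a)} \<inter> T = {}" by (auto simp: T_def)
  ultimately have "\<exists>c b. c \<noteq> 0 \<and> (\<forall>z\<in>{(a, f a)}. c \<bullet> z \<le> b) \<and> (\<forall>z\<in>T. b \<le> c \<bullet> z)"
    by (intro separating_hyperplane_sets) simp_all
  then obtain c b where c: "c \<noteq> 0" and le: "c \<bullet> (a, f a) \<le> b" and ge: "\<And>z. z \<in> T \<Longrightarrow> b \<le> c \<bullet> z"
    by blast
  obtain c1 c2 where c12: "c = (c1, c2)" by (cases c)
  have sep: "c1 \<bullet> a + c2 * f a \<le> c1 \<bullet> x + c2 * y" if "f x < y" for x y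
    using le ge[of "(x, y)"] that by (auto simp: T_def c12)
  have "0 \<le> c2" using sep[of a "f a + 1"] by (simp add: algebra_simps)
  \<comment> \<open>A vertical hyperplane would bound \<open>c1 \<bullet> x\<close> from below over
    all \<open>x\<close>, because \<open>f\<close> is finite everywhere; the point
    \<open>a - c1\<close> refutes this.\<close>
  moreover have "c2 \<noteq> 0"
  proof
    assume "c2 = 0"
    then have "c1 \<bullet> c1 \<le> 0"
      using sep[of "a - c1" "f (a - c1) + 1"] by (simp add: inner_diff_right)
    then have "c1 = 0" by (metis inner_gt_zero_iff not_less)
    then show False using c \<open>c2 = 0\<close> c12 by (simp add: zero_prod_def)
  qed
  ultimately have "0 < c2" by simp
  have "f a + (- c1 /\<^sub>R c2) \<bullet> (x - a) \<le> f x" for x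
  \<comment> \<open>The separation is known only strictly above the graph, hence the margin
    \<open>e\<close>.\<close>
  proof (rule field_le_epsilon)
    fix e :: real assume "0 < e"
    then have div: "(c1 \<bullet> a + c2 * f a) / c2 \<le> (c1 \<bullet> x + c2 * (f x + e)) / c2"
      using sep[of x "f x + e"] \<open>0 < c2\<close> by (intro divide_right_mono) auto
    show "f a + (- c1 /\<^sub>R c2) \<bullet> (x - a) \<le> f x + e"
    proof -
      have "c1 \<bullet> a / c2 + f a \<le> c1 \<bullet> x / c2 + (f x + e)"
        using div \<open>0 < c2\<close> by (simp add: add_divide_distrib)
      then show ?thesis by (simp add: inner_diff_right divide_inverse_commute right_diff_distrib)
    qed
  qed
  then show thesis by (rule that)
qed

lemma borel_measurable_convex_on_UNIV:
  fixes f :: "'a::euclidean_space \<Rightarrow> real"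
  shows "convex_on UNIV f \<Longrightarrow> f \<in> borel_measurable borel"
  by (intro borel_measurable_continuous_onI convex_on_continuous) simp_all

section \<open>Support functions of bounded sets\<close>

definition sup_inner :: "'a::real_inner set \<Rightarrow> 'a \<Rightarrow> real" where
  "sup_inner S G = (SUP q\<in>S. G \<bullet> q)"

context
  fixes S :: "'a::euclidean_space set" and R :: real
  assumes S: "S \<noteq> {}" "\<And>q. q \<in> S \<Longrightarrow> norm q \<le> R"
begin

lemma abs_inner_le_sup_inner_bound: "q \<in> S \<Longrightarrow> \<bar>G \<bullet> q\<bar> \<le> R * norm G"
  using Cauchy_Schwarz_ineq2[of G q] mult_left_mono[OF S(2)[of q], of "norm G"] by (simp add: mult.commute)

lemma inner_le_sup_inner: "q \<in> S \<Longrightarrow> G \<bullet> q \<le> sup_inner S G"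
  unfolding sup_inner_def
  by (rule cSUP_upper) (auto intro!: bdd_aboveI2 abs_inner_le_sup_inner_bound[THEN abs_le_D1])

lemma sup_inner_le: "(\<And>q. q \<in> S \<Longrightarrow> G \<bullet> q \<le> b) \<Longrightarrow> sup_inner S G \<le> b"
  unfolding sup_inner_def using S by (intro cSUP_least) auto

lemma abs_sup_inner_le: "\<bar>sup_inner S G\<bar> \<le> R * norm G"
proof -
  obtain q where q: "q \<in> S" using S by blast
  have "sup_inner S G \<le> R * norm G"
    by (rule sup_inner_le) (use abs_inner_le_sup_inner_bound abs_le_D1 in blast)
  moreover have "- (R * norm G) \<le> sup_inner S G"
    using abs_inner_le_sup_inner_bound[OF q, of G] inner_le_sup_inner[OF q, of G] by linarith
  ultimately show ?thesis by simp
qed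

text \<open>The supremum may be uncountable, but a finite supremum of linear functionals is convex,
  hence continuous.\<close>

lemma borel_measurable_sup_inner: "sup_inner S \<in> borel_measurable borel"
proof (rule borel_measurable_convex_on_UNIV, rule convex_onI)
  fix t :: real and G H assume t: "0 < t" "t < 1"
  show "sup_inner S ((1 - t) *\<^sub>R G + t *\<^sub>R H) \<le> (1 - t) * sup_inner S G + t * sup_inner S H"
  proof (rule sup_inner_le)
    fix q assume "q \<in> S"
    then show "((1 - t) *\<^sub>R G + t *\<^sub>R H) \<bullet> q \<le> (1 - t) * sup_inner S G + t * sup_inner S H"
      using t by (simp add: inner_add_left add_mono mult_left_mono inner_le_sup_inner)
  qed
qed simp

lemma integrable_sup_inner:
  assumes [measurable]: "g \<in> borel_measurable M" and g: "integrable M (\<lambda>x. norm (g x))"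
  shows "integrable M (\<lambda>x. sup_inner S (g x))"
proof (rule Bochner_Integration.integrable_bound)
  show "integrable M (\<lambda>x. R * norm (g x))" using g by simp
  show "(\<lambda>x. sup_inner S (g x)) \<in> borel_measurable M"
    by (rule measurable_compose[OF _ borel_measurable_sup_inner]) measurable
  show "AE x in M. norm (sup_inner S (g x)) \<le> norm (R * norm (g x))"
    by (rule AE_I2) (metis abs_ge_self abs_sup_inner_le order_trans real_norm_def)
qed

end

section \<open>Convex domination\<close>

context haar_and_invariant
begin

lemma integrable_haar_continuous:
  assumes f: "continuous_on UNIV f"
  shows "integrable \<mu> (\<lambda>q. f q :: real)"
proof -
  have "compact (f ` cball 0 (sqrt CARD('k)))"
    by (intro compact_continuous_image continuous_on_subset[OF f]) auto
  then obtain B where B: "\<And>q. q \<in> cball 0 (sqrt CARD('k)) \<Longrightarrow> norm (f q) \<le> B"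
    by (metis bounded_iff compact_imp_bounded image_eqI)
  show ?thesis
  proof (rule H.integrable_const_bound)
    show "AE q in \<mu>. norm (f q) \<le> B"
      using AE_stiefel by eventually_elim (rule B, simp add: norm_stiefel)
    show "f \<in> borel_measurable \<mu>"
      using borel_measurable_continuous_onI[OF f] by simp
  qed
qed

text \<open>Integrate the affine minorant of \<open>f\<close> that touches at the barycenter against
  the probability density \<open>gibbs l q\<close>.\<close>

lemma jensen_gibbs:
  assumes f: "convex_on UNIV f" and q: "q \<in> stiefel"
    and int: "integrable \<gamma> (\<lambda>G. gibbs l q G * f G)"
  shows "f (barycenter l q) \<le> (\<integral>G. gibbs l q G * f G \<partial>\<gamma>)"
proof -
  define b where "b = barycenter l q"
  obtain s where s: "\<And>x. f b + s \<bullet> (x - b) \<le> f x"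
    using convex_on_UNIV_subgradient[OF f, of b] by blast
  note I1 = integrable_gibbs_gamma[OF q, of l]
  note I2 = integrable_inner_left[OF integrable_gibbs_scaleR[OF q, of l], of s]
  have "f b = (\<integral>G. gibbs l q G * (f b - s \<bullet> b) + (gibbs l q G *\<^sub>R G) \<bullet> s \<partial>\<gamma>)"
    using I1 I2 integral_gibbs_gamma[OF q, of l] integral_inner_left[OF integrable_gibbs_scaleR[OF q, of l], of s]
    by (simp add: b_def barycenter_def inner_commute)
  also have "\<dots> \<le> (\<integral>G. gibbs l q G * f G \<partial>\<gamma>)"
  proof (rule integral_mono[OF _ int])
    show "integrable \<gamma> (\<lambda>G. gibbs l q G * (f b - s \<bullet> b) + (gibbs l q G *\<^sub>R G) \<bullet> s)"
      using I1 I2 by simp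
    fix G
    show "gibbs l q G * (f b - s \<bullet> b) + (gibbs l q G *\<^sub>R G) \<bullet> s \<le> gibbs l q G * f G"
      using mult_left_mono[OF s[of G] gibbs_nonneg[of l q G]]
      by (simp add: algebra_simps inner_diff_right inner_commute)
  qed
  finally show ?thesis by (simp add: b_def)
qed

text \<open>Conditional Jensen for the coupling, averaged over \<open>q\<close>; Fubini and the
  normalization in \<open>q\<close> then remove the kernel.\<close>

lemma convex_domination_barycenter:
  assumes f: "convex_on UNIV f" and int: "integrable \<gamma> f"
    and \<beta>: "\<And>q. q \<in> stiefel \<Longrightarrow> barycenter l q = \<beta> *\<^sub>R q"
  shows "(\<integral>q. f (\<beta> *\<^sub>R q) \<partial>\<mu>) \<le> (\<integral>G. f G \<partial>\<gamma>)"
proof -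
  have [measurable]: "f \<in> borel_measurable borel" using f by (rule borel_measurable_convex_on_UNIV)
  have I: "integrable (\<mu> \<Otimes>\<^sub>M \<gamma>) (\<lambda>(q, G). gibbs l q G * f G)"
    using integrable_gibbs_pair[of "\<lambda>(q, G). f G" "\<lambda>G. \<bar>f G\<bar>" l] int by simp
  have "continuous_on UNIV (\<lambda>q. f (\<beta> *\<^sub>R q))"
    by (rule continuous_on_compose2[OF convex_on_continuous[OF open_UNIV f]]) (auto intro!: continuous_intros)
  then have "(\<integral>q. f (\<beta> *\<^sub>R q) \<partial>\<mu>) \<le> (\<integral>q. (\<integral>G. gibbs l q G * f G \<partial>\<gamma>) \<partial>\<mu>)"
  proof (rule integral_mono_AE[OF integrable_haar_continuous])
    show "integrable \<mu> (\<lambda>q. \<integral>G. gibbs l q G * f G \<partial>\<gamma>)"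
      using integrable_fst'[OF I] by simp
    show "AE q in \<mu>. f (\<beta> *\<^sub>R q) \<le> (\<integral>G. gibbs l q G * f G \<partial>\<gamma>)"
      using AE_stiefel AE_integrable_fst'[OF I]
      by eventually_elim (use jensen_gibbs[OF f] \<beta> in fastforce)
  qed
  also have "\<dots> = (\<integral>G. (\<integral>q. gibbs l q G * f G \<partial>\<mu>) \<partial>\<gamma>)"
    by (rule Fubini_integral[symmetric, OF I])
  also have "\<dots> = (\<integral>G. f G \<partial>\<gamma>)"
    by (simp add: integral_gibbs_haar)
  finally show ?thesis .
qed

section \<open>Concentration of the Gibbs kernel for large \<open>l\<close>\<close>

lemma measure_ball_stiefel_eq:
  assumes "q \<in> stiefel" "q' \<in> stiefel"
  shows "measure \<mu> (ball q' e) = measure \<mu> (ball q e)"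
proof -
  obtain U where U: "orthogonal_matrix U" "U ** q = q'" using stiefel_transitive[OF assms] .
  have "dist q' (U ** x) = dist q x" for x :: "real^'k^'n"
  proof -
    have "q' - U ** x = U ** (q - x) ** mat 1"
      using matrix_mult_diff_distrib(2)[of U q x] by (simp add: U)
    then show ?thesis
      using inner_orthogonal_mult[OF U(1) orthogonal_matrix_mat_1, of "q - x" "q - x"]
      by (simp add: dist_norm norm_eq_sqrt_inner)
  qed
  then have *: "(\<lambda>x. U ** x ** mat 1) -` ball q' e \<inter> space \<mu> = ball q e" by auto
  have "measure (distr \<mu> borel (\<lambda>x. U ** x ** mat 1)) (ball q' e) = measure \<mu> (ball q e)"
    unfolding *[symmetric] by (rule measure_distr) measurable
  then show ?thesis by (simp only: haar_invariant[OF U(1) orthogonal_matrix_mat_1])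
qed

text \<open>If one such ball were null, all would be, by transitivity; by Lindelof countably many of
  them cover the Stiefel manifold, which has full measure.\<close>

lemma measure_ball_stiefel_pos:
  assumes q: "q \<in> stiefel" and e: "0 < e"
  shows "0 < measure \<mu> (ball q e)"
proof (rule ccontr)
  assume "\<not> 0 < measure \<mu> (ball q e)"
  then have "measure \<mu> (ball q e) = 0" using measure_nonneg[of \<mu> "ball q e"] by linarith
  then have null: "ball q' e \<in> null_sets \<mu>" if "q' \<in> stiefel" for q' :: "real^'k^'n"
    using measure_ball_stiefel_eq[OF q that, of e] by (simp add: null_sets_def H.emeasure_eq_measure)
  obtain F where F: "F \<subseteq> (\<lambda>q. ball q e) ` (stiefel :: (real^'k^'n) set)" "countable F"
    "\<Union>F = \<Union>((\<lambda>q. ball q e) ` (stiefel :: (real^'k^'n) set))"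
    using Lindelof[of "(\<lambda>q. ball q e) ` (stiefel :: (real^'k^'n) set)"] by blast
  have "\<Union>F \<in> null_sets \<mu>"
    using null F(1) by (intro null_sets_UN'[OF F(2), of id, simplified]) auto
  then have out: "AE q in \<mu>. q \<notin> \<Union>F" by (rule AE_not_in)
  have sub: "stiefel \<subseteq> \<Union>F" unfolding F(3) using e by auto
  from AE_stiefel out have "AE q in \<mu>. False"
    by eventually_elim (use sub in blast)
  then show False using H.AE_False by simp
qed

text \<open>The lower bound of Laplace's method: keep only the ball around \<open>q\<close>, on
  which \<open>G \<bullet> x\<close> differs from \<open>G \<bullet> q\<close> by at most
  \<open>e * norm G\<close>.\<close>

lemma ln_normalizer_ge:
  assumes q: "q \<in> stiefel" and e: "0 < e" and l: "0 < l"
  shows "l * (G \<bullet> q - e * norm G) + ln (measure \<mu> (ball q e)) \<le> ln (normalizer l G)"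
proof -
  let ?c = "exp (l * (G \<bullet> q - e * norm G))"
  have "measure \<mu> (ball q e) * ?c = (\<integral>x. indicator (ball q e) x * ?c \<partial>\<mu>)"
    by simp
  also have "\<dots> \<le> normalizer l G"
    unfolding normalizer_def
  proof (rule integral_mono[OF _ integrable_exp_inner])
    show "integrable \<mu> (\<lambda>x. indicator (ball q e) x * ?c)"
      by (intro integrable_mult_left integrable_real_indicator) (auto simp: H.emeasure_eq_measure)
    fix x
    show "indicator (ball q e) x * ?c \<le> exp (l * (G \<bullet> x))"
    proof (cases "x \<in> ball q e")
      case True
      then have "\<bar>G \<bullet> (q - x)\<bar> \<le> norm G * e"
        using Cauchy_Schwarz_ineq2[of G "q - x"] mult_left_mono[of "norm (q - x)" e "norm G"]
        by (simp add: dist_norm)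
      then have "G \<bullet> q - e * norm G \<le> G \<bullet> x" by (simp add: inner_diff_right mult.commute)
      with l True show ?thesis by simp
    qed simp
  qed
  finally have "ln (measure \<mu> (ball q e) * ?c) \<le> ln (normalizer l G)"
    using measure_ball_stiefel_pos[OF q e] by (subst ln_le_cancel_iff) (auto simp: normalizer_pos)
  then show ?thesis
    using measure_ball_stiefel_pos[OF q e] by (simp add: ln_mult)
qed

lemma integrable_gibbs_inner_haar: "integrable \<mu> (\<lambda>q. gibbs l q G * (G \<bullet> q))"
proof -
  have "normalizer l G \<noteq> 0" using normalizer_pos[of l G] by linarith
  then show ?thesis
    unfolding gibbs_def by (intro integrable_haar_continuous continuous_intros) simp
qed

text \<open>Nonnegativity of the relative entropy of the Gibbs measure with respect to \<open>\<mu>\<close>.\<close>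

lemma ln_normalizer_le:
  "ln (normalizer l G) \<le> l * (\<integral>q. gibbs l q G * (G \<bullet> q) \<partial>\<mu>)"
proof -
  \<comment> \<open>The left integral is 0, since the kernel and the constant 1 both have mass 1.
    The pointwise inequality is x - 1 \<le> x ln x at \<open>gibbs l q G\<close>.\<close>
  have "(\<integral>q. gibbs l q G - 1 \<partial>\<mu>) \<le> (\<integral>q. l * (gibbs l q G * (G \<bullet> q)) - gibbs l q G * ln (normalizer l G) \<partial>\<mu>)"
  proof (rule integral_mono)
    fix q
    let ?k = "gibbs l q G"
    have pos: "0 < ?k" using normalizer_pos[of l G] by (simp add: gibbs_def)
    have "?k * (1 - 1 / ?k) \<le> ?k * ln ?k"
      using ln_le_minus_one[of "1 / ?k"] pos by (intro mult_left_mono) (auto simp: ln_div)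
    moreover have "ln ?k = l * (G \<bullet> q) - ln (normalizer l G)"
      using normalizer_pos[of l G] by (simp add: gibbs_def ln_div)
    ultimately show "?k - 1 \<le> l * (?k * (G \<bullet> q)) - ?k * ln (normalizer l G)"
      using pos by (simp add: algebra_simps)
  qed (use integrable_gibbs_haar integrable_gibbs_inner_haar in auto)
  then show ?thesis
    using integrable_gibbs_haar integrable_gibbs_inner_haar
    by (simp add: integral_gibbs_haar)
qed

lemma stiefel_nonempty: "(stiefel :: (real^'k^'n) set) \<noteq> {}"
proof
  assume "(stiefel :: (real^'k^'n) set) = {}"
  then have "AE q in \<mu>. False" using AE_stiefel by simp
  then show False using H.AE_False by simp
qed

text \<open>Comparing the two bounds on \<open>ln (normalizer l G)\<close> shows that the Gibbs mean
  of \<open>G \<bullet> q\<close> nearly attains the supremum. Averaged over \<open>G\<close> and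
  with the integrals exchanged, this mean becomes the inner product of the barycenter with
  \<open>q\<close>.\<close>

lemma barycenter_near_optimal:
  assumes "0 < \<eta>"
  obtains l \<beta> where "\<And>q. q \<in> stiefel \<Longrightarrow> barycenter l q = \<beta> *\<^sub>R q"
    "(\<integral>G. sup_inner stiefel G \<partial>\<gamma>) - \<eta> \<le> \<beta> * CARD('k)"
proof -
  obtain q0 :: "real^'k^'n" where q0: "q0 \<in> stiefel" using stiefel_nonempty by blast
  have bnd: "norm q \<le> sqrt CARD('k)" if "q \<in> stiefel" for q :: "real^'k^'n"
    using norm_stiefel[OF that] by simp
  define m where "m = (\<integral>G. norm G \<partial>\<gamma>)"
  have "0 \<le> m" by (simp add: m_def)
  \<comment> \<open>Half of the error \<open>\<eta>\<close> is spent on \<open>e * m\<close>; the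
    added 1 keeps the denominator positive.\<close>
  define e where "e = \<eta> / (2 * (m + 1))"
  have e: "0 < e" using assms \<open>0 \<le> m\<close> by (simp add: e_def)
  have em: "e * m \<le> \<eta> / 2" using assms \<open>0 \<le> m\<close> by (simp add: e_def field_simps)
  define p where "p = measure \<mu> (ball q0 e)"
  have p: "0 < p" "p \<le> 1" using measure_ball_stiefel_pos[OF q0 e] by (simp_all add: p_def)
  \<comment> \<open>The other half is spent on \<open>ln p / l\<close>; using
    \<open>1 - ln p\<close> instead of \<open>- ln p\<close> keeps \<open>l\<close> positive when
    \<open>p = 1\<close>.\<close>
  define l where "l = 2 * (1 - ln p) / \<eta>"
  have "ln p \<le> 0" using p by simp
  then have l: "0 < l" using assms by (simp add: l_def)
  have lp: "- \<eta> / 2 \<le> ln p / l"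
    using assms \<open>ln p \<le> 0\<close> by (simp add: l_def field_simps)
  obtain \<beta> where \<beta>: "\<And>q. q \<in> stiefel \<Longrightarrow> barycenter l q = \<beta> *\<^sub>R q"
    using barycenter_scalar[of l] by metis
  have lower: "sup_inner stiefel G - e * norm G + ln p / l \<le> (\<integral>q. gibbs l q G * (G \<bullet> q) \<partial>\<mu>)" for G
  proof -
    have "sup_inner stiefel G \<le> (\<integral>q. gibbs l q G * (G \<bullet> q) \<partial>\<mu>) + e * norm G - ln p / l"
    proof (rule sup_inner_le[OF stiefel_nonempty bnd])
      fix q :: "real^'k^'n" assume q: "q \<in> stiefel"
      \<comment> \<open>By invariance the ball around \<open>q\<close> has the same measure
        \<open>p\<close> as the ball around \<open>q0\<close>, so the bound is uniform in
        \<open>q\<close> and passes to the supremum.\<close>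
      have "l * (G \<bullet> q - e * norm G) + ln p \<le> l * (\<integral>q. gibbs l q G * (G \<bullet> q) \<partial>\<mu>)"
        using ln_normalizer_ge[OF q e l, of G] ln_normalizer_le[of l G] measure_ball_stiefel_eq[OF q0 q, of e]
        by (simp add: p_def)
      then have "(l * (G \<bullet> q - e * norm G) + ln p) / l \<le> l * (\<integral>q. gibbs l q G * (G \<bullet> q) \<partial>\<mu>) / l"
        using l by (intro divide_right_mono) auto
      then show "G \<bullet> q \<le> (\<integral>q. gibbs l q G * (G \<bullet> q) \<partial>\<mu>) + e * norm G - ln p / l"
        using l by (simp add: add_divide_distrib)
    qed
    then show ?thesis by simp
  qed
  have I: "integrable (\<mu> \<Otimes>\<^sub>M \<gamma>) (\<lambda>(q, G). gibbs l q G * (G \<bullet> q))"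
    using integrable_gibbs_pair[of "\<lambda>(q, G). G \<bullet> q" "\<lambda>G. sqrt CARD('k) * norm G" l] integrable_norm
    by (simp add: abs_inner_stiefel_le)
  have int_sup: "integrable \<gamma> (sup_inner stiefel)"
    using integrable_norm by (intro integrable_sup_inner[OF stiefel_nonempty bnd, where g="\<lambda>x. x"]) auto
  have "(\<integral>G. sup_inner stiefel G \<partial>\<gamma>) - \<eta> \<le> (\<integral>G. sup_inner stiefel G \<partial>\<gamma>) - e * m + ln p / l"
    using em lp by simp
  also have "\<dots> = (\<integral>G. sup_inner stiefel G - e * norm G + ln p / l \<partial>\<gamma>)"
    using int_sup integrable_norm by (simp add: m_def)
  also have "\<dots> \<le> (\<integral>G. (\<integral>q. gibbs l q G * (G \<bullet> q) \<partial>\<mu>) \<partial>\<gamma>)"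
    using int_sup integrable_norm integrable_snd[OF I] lower by (intro integral_mono) auto
  also have "\<dots> = (\<integral>q. (\<integral>G. gibbs l q G * (G \<bullet> q) \<partial>\<gamma>) \<partial>\<mu>)"
    by (rule Fubini_integral[OF I])
  also have "\<dots> = (\<integral>q. \<beta> * CARD('k) \<partial>\<mu>)"
  proof (rule integral_cong_AE)
    show "AE q in \<mu>. (\<integral>G. gibbs l q G * (G \<bullet> q) \<partial>\<gamma>) = \<beta> * CARD('k)"
      using AE_stiefel
    proof eventually_elim
      case (elim q)
      have "(\<integral>G. gibbs l q G * (G \<bullet> q) \<partial>\<gamma>) = barycenter l q \<bullet> q"
        using integral_inner_left[OF integrable_gibbs_scaleR[OF elim, of l], of q]
        by (simp add: barycenter_def)
      then show ?case using \<beta>[OF elim] inner_stiefel_self[OF elim] by simp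
    qed
  qed (use integrable_fst[OF I] in auto)
  also have "\<dots> = \<beta> * CARD('k)" by simp
  finally show thesis using that \<beta> by blast
qed

text \<open>
  The near-optimal \<open>\<beta>\<close> may exceed \<open>a\<close>; this does no harm because \<open>t \<mapsto> E f(t Q)\<close> is convex and
  even, hence nondecreasing for \<open>t \<ge> 0\<close>.
\<close>

lemma convex_domination:
  fixes a :: real
  assumes f: "convex_on UNIV f" and int: "integrable \<gamma> f"
    and a: "0 < a" "a * CARD('k) \<le> (\<integral>G. sup_inner stiefel G \<partial>\<gamma>)"
  shows "(\<integral>q. f (a *\<^sub>R q) \<partial>\<mu>) \<le> (\<integral>G. f G \<partial>\<gamma>)"
proof -
  define h where "h t = (\<integral>q. f (t *\<^sub>R q) \<partial>\<mu>)" for t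
  have [measurable]: "f \<in> borel_measurable borel" using f by (rule borel_measurable_convex_on_UNIV)
  have int_f: "integrable \<mu> (\<lambda>q. f (t *\<^sub>R q))" for t
    by (intro integrable_haar_continuous continuous_on_compose2[OF convex_on_continuous[OF open_UNIV f]])
       (auto intro!: continuous_intros)
  have conv: "convex_on UNIV h"
  proof (rule convex_onI)
    fix t x y :: real assume t: "0 < t" "t < 1"
    have "h ((1 - t) *\<^sub>R x + t *\<^sub>R y) \<le> (\<integral>q. (1 - t) * f (x *\<^sub>R q) + t * f (y *\<^sub>R q) \<partial>\<mu>)"
      unfolding h_def
    proof (rule integral_mono[OF int_f])
      fix q
      show "f (((1 - t) *\<^sub>R x + t *\<^sub>R y) *\<^sub>R q) \<le> (1 - t) * f (x *\<^sub>R q) + t * f (y *\<^sub>R q)"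
        using convex_onD[OF f, of t "x *\<^sub>R q" "y *\<^sub>R q"] t by (simp add: scaleR_add_left)
    qed (use int_f in auto)
    also have "\<dots> = (1 - t) * h x + t * h y" using int_f by (simp add: h_def)
    finally show "h ((1 - t) *\<^sub>R x + t *\<^sub>R y) \<le> (1 - t) * h x + t * h y" .
  qed simp
  have even: "h (- t) = h t" for t
  proof -
    have U: "orthogonal_matrix (- mat 1 :: real^'n^'n)"
    proof -
      have "- mat 1 = signed_involution (\<lambda>i :: 'n. i) (\<lambda>_. - 1)"
        by (simp add: signed_involution_def mat_def vec_eq_iff)
      then show ?thesis using orthogonal_signed_involution[of "\<lambda>i :: 'n. i" "\<lambda>_. - 1"] by simp
    qed
    have neg: "(- mat 1) ** q ** mat 1 = - q" for q :: "real^'k^'n"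
      using matrix_mult_diff_distrib(1)[of 0 "mat 1 :: real^'n^'n" q] by simp
    have "h t = (\<integral>q. f (t *\<^sub>R q) \<partial>distr \<mu> borel (\<lambda>q. (- mat 1) ** q ** mat 1))"
      by (simp only: h_def haar_invariant[OF U orthogonal_matrix_mat_1])
    also have "\<dots> = h (- t)"
      by (subst integral_distr, measurable) (simp only: neg h_def scaleR_minus_right scaleR_minus_left)
    finally show ?thesis ..
  qed
  have mono: "h s \<le> h t" if "0 \<le> s" "s \<le> t" for s t
  proof (cases "t = 0")
    case False
    \<comment> \<open>The weight that writes \<open>s\<close> as a convex combination of
      \<open>- t\<close> and \<open>t\<close>, where \<open>h\<close> takes the same value.\<close>
    define u where "u = (s + t) / (2 * t)"
    have u: "0 \<le> u" "u \<le> 1" and "2 * t * u = s + t"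
      using that False by (simp_all add: u_def divide_simps)
    then have s: "s = (1 - u) *\<^sub>R (- t) + u *\<^sub>R t"
      by (simp add: algebra_simps)
    have "h s \<le> (1 - u) * h (- t) + u * h t"
      using convex_onD[OF conv, of u "- t" t] u s by simp
    then show ?thesis by (simp add: even algebra_simps)
  qed (use that in simp)
  \<comment> \<open>The factor \<beta> is only known to be at least \<open>a - \<eta>\<close>. The
    limit to \<open>a\<close> uses continuity of the convex function \<open>h\<close>.\<close>
  have step: "h (a - \<eta>) \<le> (\<integral>G. f G \<partial>\<gamma>)" if \<eta>: "0 < \<eta>" "\<eta> < a" for \<eta> :: real
  proof -
    have "0 < \<eta> * CARD('k)" using \<eta> by simp
    then obtain l \<beta> where \<beta>: "\<And>q. q \<in> stiefel \<Longrightarrow> barycenter l q = \<beta> *\<^sub>R q"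
      "(\<integral>G. sup_inner stiefel G \<partial>\<gamma>) - \<eta> * CARD('k) \<le> \<beta> * CARD('k)"
      by (rule barycenter_near_optimal) blast
    have "(a - \<eta>) * CARD('k) \<le> \<beta> * CARD('k)" using a(2) \<beta>(2) by (simp add: algebra_simps)
    then have "a - \<eta> \<le> \<beta>" by simp
    then have "h (a - \<eta>) \<le> h \<beta>" using mono \<eta> by simp
    also have "\<dots> \<le> (\<integral>G. f G \<partial>\<gamma>)"
      unfolding h_def by (rule convex_domination_barycenter[OF f int \<beta>(1)])
    finally show ?thesis .
  qed
  have "isCont h a"
    using convex_on_continuous[OF open_UNIV conv] by (simp add: continuous_on_eq_continuous_at)
  then have "((\<lambda>\<eta>. h (a - \<eta>)) \<longlongrightarrow> h (a - 0)) (at_right 0)"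
    by (intro isCont_tendsto_compose[of _ h] tendsto_intros) simp_all
  then have "h (a - 0) \<le> (\<integral>G. f G \<partial>\<gamma>)"
    by (rule tendsto_upperbound)
       (use step a in \<open>auto simp: eventually_at_right_field intro!: exI[of _ a]\<close>)
  then show ?thesis by (simp add: h_def)
qed

end

section \<open>Frames and the chi-square lower bound\<close>

text \<open>
  The columns with index in \<open>C\<close> are orthonormal and the others vanish, so that partial frames live
  in the same matrix space.
\<close>

definition frames :: "'k set \<Rightarrow> (real^'k^'n) set" where
  "frames C = {q. \<forall>i j. (\<Sum>l\<in>UNIV. q$l$i * q$l$j) = (if i = j \<and> i \<in> C then 1 else 0)}"

lemma frames_iff_gram:
  "q \<in> frames C \<longleftrightarrow> transpose q ** q = (\<chi> i j. if i = j \<and> i \<in> C then 1 else 0)"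
  for q :: "real^'k^'n"
  by (simp add: frames_def vec_eq_iff matrix_matrix_mult_def transpose_def)

lemma frames_UNIV: "frames UNIV = stiefel"
  by (auto simp: frames_iff_gram stiefel_def mat_def)

lemma frames_zero_column:
  assumes "q \<in> frames C" "j \<notin> C"
  shows "q$l$j = 0"
proof -
  have "(\<Sum>l\<in>UNIV. q$l$j * q$l$j) = 0" using assms by (auto simp: frames_def)
  then show ?thesis by (simp add: sum_nonneg_eq_0_iff)
qed

lemma norm_frames_le:
  fixes q :: "real^'k^'n"
  assumes "q \<in> frames C"
  shows "norm q \<le> sqrt CARD('k)"
proof -
  have "q \<bullet> q = (\<Sum>j\<in>UNIV. \<Sum>l\<in>UNIV. q$l$j * q$l$j)"
    by (simp add: inner_vec_def) (rule sum.swap)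
  also have "\<dots> \<le> (\<Sum>j\<in>(UNIV :: 'k set). 1)"
    using assms by (intro sum_mono) (simp add: frames_def)
  finally show ?thesis by (simp add: norm_eq_sqrt_inner)
qed

text \<open>The Gram matrix is the coordinate projection onto \<open>C\<close>, and it acts
  trivially on \<open>q\<close> because the columns of \<open>q\<close> outside \<open>C\<close>
  vanish.\<close>

lemma frames_partial_isometry:
  fixes q :: "real^'k^'n"
  assumes "q \<in> frames C"
  shows "q ** transpose q ** q = q"
proof -
  have "(\<Sum>i\<in>UNIV. q$l$i * (if i = j \<and> i \<in> C then 1 else 0)) = q$l$j" for l j
  proof -
    have "(\<Sum>i\<in>UNIV. q$l$i * (if i = j \<and> i \<in> C then 1 else 0)) =
      (\<Sum>i\<in>UNIV. if i = j then (if j \<in> C then q$l$j else 0) else 0)"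
      by (intro sum.cong) auto
    then show ?thesis using frames_zero_column[OF assms, of j l] by simp
  qed
  then have "q ** (\<chi> i j. if i = j \<and> i \<in> C then 1 else 0) = q"
    by (simp add: vec_eq_iff matrix_matrix_mult_def)
  then show ?thesis
    using assms by (simp add: frames_iff_gram flip: matrix_mul_assoc)
qed

lemma orthogonal_mult_in_frames:
  assumes "orthogonal_matrix U" "q \<in> frames C"
  shows "U ** q \<in> frames C"
  using assms(2)
  by (simp add: frames_iff_gram matrix_transpose_mul orthogonal_matrix_transpose_mult(1)[OF assms(1)]
      flip: matrix_mul_assoc)

text \<open>A reference frame made of distinct coordinate vectors when \<open>s\<close> is injective
  on \<open>C\<close>; the orthogonal group moves it to any other element of
  \<open>frames C\<close>.\<close>

definition coordinate_frame :: "('k \<Rightarrow> 'n) \<Rightarrow> 'k set \<Rightarrow> real^'k^'n" where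
  "coordinate_frame s C = (\<chi> l j. if j \<in> C \<and> l = s j then 1 else 0)"

lemma coordinate_frame_in_frames:
  assumes "inj_on s C"
  shows "coordinate_frame s C \<in> frames C"
proof -
  have "(\<Sum>l\<in>UNIV. (if i \<in> C \<and> l = s i then 1 else 0) * (if j \<in> C \<and> l = s j then 1 else 0)) =
    (\<Sum>l\<in>UNIV. if l = s i then (if i \<in> C \<and> j \<in> C \<and> s i = s j then 1 else 0) else 0 :: real)" for i j
    by (intro sum.cong) auto
  then have *: "(\<Sum>l\<in>UNIV. (if i \<in> C \<and> l = s i then 1 else 0) * (if j \<in> C \<and> l = s j then 1 else 0)) =
    (if i \<in> C \<and> j \<in> C \<and> s i = s j then 1 else 0 :: real)" for i j
    by simp
  show ?thesis
    unfolding frames_def coordinate_frame_def mem_Collect_eq vec_lambda_beta *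
    using assms by (auto dest: inj_onD)
qed

lemma frames_nonempty:
  assumes "CARD('k) \<le> CARD('n)"
  shows "frames C \<noteq> ({} :: (real^'k^'n) set)"
proof -
  obtain s :: "'k \<Rightarrow> 'n" where "inj s"
    using assms card_le_inj[of "UNIV :: 'k set" "UNIV :: 'n set"] by auto
  then show ?thesis using coordinate_frame_in_frames[of s C] by (auto simp: inj_on_def)
qed

definition replace_column :: "'k \<Rightarrow> real^'k^'n \<Rightarrow> real^'k^'n \<Rightarrow> real^'k^'n" where
  "replace_column j G H = (\<chi> l a. if a = j then H$l$a else G$l$a)"

text \<open>
  Swapping one column between two independent copies is orthogonal on the product space. Hence
  resampling a column of a Gaussian matrix preserves its law, which replaces conditioning on the
  other columns.
\<close>

lemma orthogonal_transformation_swap_column: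
  "orthogonal_transformation (\<lambda>(G, H). (replace_column j G H, replace_column j H G))"
  unfolding orthogonal_transformation_def
proof
  show "linear (\<lambda>(G, H). (replace_column j G H, replace_column j H G))"
    by (rule linearI) (auto simp: replace_column_def vec_eq_iff)
  show "\<forall>v w. (case v of (G, H) \<Rightarrow> (replace_column j G H, replace_column j H G)) \<bullet>
      (case w of (G, H) \<Rightarrow> (replace_column j G H, replace_column j H G)) = v \<bullet> w"
    by (auto simp: replace_column_def inner_vec_def inner_Pair simp flip: sum.distrib intro!: sum.cong)
qed

lemma distr_replace_column:
  "distr (std_gaussian \<Otimes>\<^sub>M std_gaussian) borel (\<lambda>(G, H). replace_column j G H) =
    (std_gaussian :: (real^'k^'n) measure)"
proof -
  interpret G: prob_space "std_gaussian :: (real^'k^'n) measure" by (rule prob_space_std_gaussian)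
  let ?S = "\<lambda>(G, H). (replace_column j G H, replace_column j H (G :: real^'k^'n))"
  have [measurable]: "?S \<in> borel_measurable borel"
    by (intro borel_measurable_linear orthogonal_transformation_linear orthogonal_transformation_swap_column)
  have [measurable]: "fst \<in> borel_measurable (borel :: ((real^'k^'n) \<times> (real^'k^'n)) measure)"
    by (intro borel_measurable_continuous_onI continuous_intros)
  have "(std_gaussian :: (real^'k^'n) measure) =
    distr (std_gaussian \<Otimes>\<^sub>M (std_gaussian :: (real^'k^'n) measure)) borel fst"
    using G.distr_pair_fst[of "std_gaussian :: (real^'k^'n) measure"]
    by (simp cong: distr_cong)
  also have "std_gaussian \<Otimes>\<^sub>M std_gaussian = distr (std_gaussian \<Otimes>\<^sub>M std_gaussian) borel ?S"
    unfolding std_gaussian_pair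
    by (rule distr_std_gaussian_orthogonal_transformation[symmetric, OF orthogonal_transformation_swap_column])
  also have "distr \<dots> borel fst = distr (std_gaussian \<Otimes>\<^sub>M std_gaussian) borel (fst \<circ> ?S)"
    unfolding std_gaussian_pair by (rule distr_distr) measurable
  also have "fst \<circ> ?S = (\<lambda>(G, H). replace_column j G H)" by auto
  finally show ?thesis ..
qed

text \<open>One Gram-Schmidt step. After rotating by \<open>transpose U\<close>, the frame
  \<open>q\<close> becomes a coordinate frame, and the rows outside its support give the projection
  of column \<open>j\<close> of \<open>H\<close> onto the orthogonal complement. The square root is
  the length of this projection, and its normalization is the new column.\<close>

lemma sup_inner_frames_insert_ge:
  fixes G H q :: "real^'k^'n" and U :: "real^'n^'n" and s :: "'k \<Rightarrow> 'n"
  assumes n: "CARD('k) \<le> CARD('n)" and j: "j \<notin> C" and s: "inj_on s C"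
    and U: "orthogonal_matrix U" "U ** coordinate_frame s C = q"
  shows "G \<bullet> q + sqrt (\<Sum>l\<in>-s ` C. ((transpose U ** H)$l$j)\<^sup>2)
    \<le> sup_inner (frames (insert j C)) (replace_column j G H)"
proof -
  define q0 :: "real^'k^'n" where "q0 = coordinate_frame s C"
  have q0: "q0 \<in> frames C" using coordinate_frame_in_frames[OF s] by (simp add: q0_def)
  define I where "I = - s ` C"
  define y where "y l = (transpose U ** H)$l$j" for l
  define r where "r = sqrt (\<Sum>l\<in>I. (y l)\<^sup>2)"
  have "card (s ` C) < CARD('n)"
  proof -
    have "C \<subset> UNIV" using j by auto
    then have "card C < CARD('k)" by (intro psubset_card_mono) auto
    moreover have "card (s ` C) \<le> card C" by (rule card_image_le) simp
    ultimately show ?thesis using n by simp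
  qed
  then obtain i0 where i0: "i0 \<in> I" unfolding I_def by (metis ComplI UNIV_I UNIV_eq_I less_irrefl)
  \<comment> \<open>The normalized projection, or the coordinate vector of \<open>i0\<close> if the
    projection vanishes.\<close>
  obtain u where u0: "\<And>l. l \<notin> I \<Longrightarrow> u l = 0" and u1: "(\<Sum>l\<in>UNIV. u l * u l) = 1"
    and uy: "(\<Sum>l\<in>UNIV. y l * u l) = r"
  proof (cases "r = 0")
    case True
    then have "(\<Sum>l\<in>I. (y l)\<^sup>2) = 0" by (simp add: r_def)
    then have y0: "y i0 = 0" using i0 by (simp add: sum_nonneg_eq_0_iff)
    show thesis
      by (rule that[of "\<lambda>l. if l = i0 then 1 else 0"]) (use i0 y0 True in \<open>auto simp: if_distrib cong: if_cong\<close>)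
  next
    case False
    have r2: "r * r = (\<Sum>l\<in>I. y l * y l)"
      by (simp add: r_def sum_nonneg power2_eq_square)
    have sumI: "(\<Sum>l\<in>UNIV. if l \<in> I then g l else 0) = sum g I" for g :: "'n \<Rightarrow> real"
      by (simp add: sum.If_cases)
    show thesis
    proof (rule that[of "\<lambda>l. if l \<in> I then y l / r else 0"])
      have "(\<Sum>l\<in>UNIV. (if l \<in> I then y l / r else 0) * (if l \<in> I then y l / r else 0)) =
        (\<Sum>l\<in>UNIV. if l \<in> I then (y l * y l) / (r * r) else 0)"
        by (intro sum.cong) auto
      also have "\<dots> = 1" using False unfolding sumI by (simp add: r2[symmetric] flip: sum_divide_distrib)
      finally show "(\<Sum>l\<in>UNIV. (if l \<in> I then y l / r else 0) * (if l \<in> I then y l / r else 0)) = 1" .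
      have "(\<Sum>l\<in>UNIV. y l * (if l \<in> I then y l / r else 0)) = (\<Sum>l\<in>UNIV. if l \<in> I then (y l * y l) / r else 0)"
        by (intro sum.cong) auto
      also have "\<dots> = r" using False unfolding sumI by (simp add: r2[symmetric] flip: sum_divide_distrib)
      finally show "(\<Sum>l\<in>UNIV. y l * (if l \<in> I then y l / r else 0)) = r" .
    qed auto
  qed
  have orth: "u l * q0$l$b = 0" for l b
    using u0[of l] by (auto simp: q0_def coordinate_frame_def I_def)
  define q1 :: "real^'k^'n" where "q1 = (\<chi> l a. if a = j then u l else q0$l$a)"
  have q1: "q1 \<in> frames (insert j C)"
    unfolding frames_def
  proof (safe, goal_cases)
    case (1 a b)
    have *: "(\<Sum>l\<in>UNIV. q0$l$a * q0$l$b) = (if a = b \<and> a \<in> C then 1 else 0)"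
      using q0 by (simp add: frames_def)
    show ?case
    proof (cases "a = j"; cases "b = j")
      assume "a = j" "b \<noteq> j"
      then show ?thesis by (simp add: q1_def orth)
    next
      assume "a \<noteq> j" "b = j"
      moreover have orth': "q0$l$a * u l = 0" for l using orth[of l a] by (simp only: mult.commute)
      ultimately show ?thesis by (simp add: q1_def orth')
    qed (use * u1 j in \<open>simp_all add: q1_def\<close>)
  qed
  \<comment> \<open>Column \<open>j\<close> contributes \<open>r\<close>. The other columns give
    \<open>G \<bullet> q\<close>, since column \<open>j\<close> of \<open>q0\<close> is
    zero.\<close>
  have "replace_column j G H \<bullet> (U ** q1) = (transpose U ** replace_column j G H) \<bullet> q1"
    using inner_matrix_mult_left[of "transpose U" "replace_column j G H" q1] by simp
  also have "\<dots> = (\<Sum>l\<in>UNIV. \<Sum>a\<in>UNIV. (if a = j then y l * u l else 0) + (transpose U ** G)$l$a * q0$l$a)"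
    unfolding inner_vec_def
  proof (simp only: inner_real_def, intro sum.cong refl)
    fix l a
    show "(transpose U ** replace_column j G H)$l$a * q1$l$a =
      (if a = j then y l * u l else 0) + (transpose U ** G)$l$a * q0$l$a"
      using frames_zero_column[OF q0 j, of l]
      by (simp add: q1_def y_def matrix_matrix_mult_def replace_column_def)
  qed
  also have "\<dots> = r + (transpose U ** G) \<bullet> q0"
    by (simp add: sum.distrib uy inner_vec_def)
  also have "(transpose U ** G) \<bullet> q0 = G \<bullet> q"
    using inner_matrix_mult_left[of "transpose U" G q0] U by (simp add: q0_def)
  finally have "G \<bullet> q + r = replace_column j G H \<bullet> (U ** q1)" by simp
  also have "\<dots> \<le> sup_inner (frames (insert j C)) (replace_column j G H)"
    by (rule inner_le_sup_inner[OF frames_nonempty[OF n] norm_frames_le])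
       (auto intro: orthogonal_mult_in_frames U q1)
  finally show ?thesis by (simp add: r_def I_def y_def)
qed

section \<open>First moments and column lengths of a Gaussian matrix\<close>

lemma standard_gaussian_matrix_integrable_norm:
  fixes \<Gamma> :: "'b \<Rightarrow> real^'k^'n"
  assumes \<Gamma>: "standard_gaussian_matrix N \<Gamma>"
  shows "integrable N (\<lambda>\<omega>. norm (\<Gamma> \<omega>))"
proof (rule Bochner_Integration.integrable_bound)
  note [measurable] = standard_gaussian_matrix_measurable[OF \<Gamma>]
  have "integrable N (\<lambda>\<omega>. \<Gamma> \<omega> $ i $ j)" for i j
    using \<Gamma> integrable_std_normal_moment[of 1]
      distributed_integrable[of N lborel "\<lambda>\<omega>. \<Gamma> \<omega> $ i $ j" std_normal_density "\<lambda>x. x"]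
    by (simp add: standard_gaussian_matrix_def)
  then show "integrable N (\<lambda>\<omega>. \<Sum>i\<in>UNIV. \<Sum>j\<in>UNIV. \<bar>\<Gamma> \<omega> $ i $ j\<bar>)"
    by simp
  have "norm G \<le> (\<Sum>i\<in>UNIV. \<Sum>j\<in>UNIV. \<bar>G $ i $ j\<bar>)" for G :: "real^'k^'n"
  proof -
    have "norm G \<le> (\<Sum>i\<in>UNIV. norm (G $ i))"
      unfolding norm_vec_def by (rule L2_set_le_sum) simp
    also have "\<dots> \<le> (\<Sum>i\<in>UNIV. \<Sum>j\<in>UNIV. \<bar>G $ i $ j\<bar>)"
      by (intro sum_mono norm_le_l1_cart)
    finally show ?thesis .
  qed
  then show "AE \<omega> in N. norm (norm (\<Gamma> \<omega>)) \<le> norm (\<Sum>i\<in>UNIV. \<Sum>j\<in>UNIV. \<bar>\<Gamma> \<omega> $ i $ j\<bar>)"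
    by (intro AE_I2) (simp add: sum_nonneg)
qed (use standard_gaussian_matrix_measurable[OF \<Gamma>] in simp)

lemma borel_measurable_entry [measurable]:
  "(\<lambda>G :: real^'k^'n. G $ l $ j) \<in> borel_measurable borel"
  by (intro borel_measurable_continuous_onI continuous_intros)

text \<open>The entries of column \<open>j\<close> with row in \<open>I\<close>, enumerated by
  \<open>e\<close>, are independent standard normals.\<close>

lemma chi_square_eq_distr:
  fixes \<Gamma> :: "'b \<Rightarrow> real^'k^'n" and I :: "'n set"
  assumes \<Gamma>: "standard_gaussian_matrix N \<Gamma>"
  shows "chi_square (card I) = distr std_gaussian borel (\<lambda>G :: real^'k^'n. \<Sum>l\<in>I. (G$l$j)\<^sup>2)"
proof -
  note [measurable] = standard_gaussian_matrix_measurable[OF \<Gamma>]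
  let ?P = "PiM {..<card I} (\<lambda>_. std_normal)"
  obtain e where e: "bij_betw e {..<card I} I"
    using ex_bij_betw_nat_finite[of I] by (auto simp: atLeast0LessThan)
  then have inj: "inj_on (\<lambda>i. (e i, j)) {..<card I}"
    by (auto simp: bij_betw_def inj_on_def)
  have [measurable]: "(\<lambda>\<omega>. \<lambda>i\<in>{..<card I}. \<Gamma> \<omega> $ e i $ j) \<in> measurable N ?P"
    by (intro measurable_restrict) simp
  have "chi_square (card I) =
    distr (distr N ?P (\<lambda>\<omega>. \<lambda>i\<in>{..<card I}. \<Gamma> \<omega> $ e i $ j)) borel (\<lambda>z. \<Sum>i<card I. (z i)\<^sup>2)"
    unfolding chi_square_def standard_gaussian_matrix_joint_law[OF \<Gamma> inj] ..
  also have "\<dots> = distr N borel ((\<lambda>z. \<Sum>i<card I. (z i)\<^sup>2) \<circ> (\<lambda>\<omega>. \<lambda>i\<in>{..<card I}. \<Gamma> \<omega> $ e i $ j))"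
    by (rule distr_distr) measurable
  also have "(\<lambda>z. \<Sum>i<card I. (z i)\<^sup>2) \<circ> (\<lambda>\<omega>. \<lambda>i\<in>{..<card I}. \<Gamma> \<omega> $ e i $ j) =
    (\<lambda>G. \<Sum>l\<in>I. (G$l$j)\<^sup>2) \<circ> \<Gamma>"
    by (auto simp: fun_eq_iff sum.reindex_bij_betw[OF e, symmetric])
  also have "distr N borel \<dots> = distr (distr N borel \<Gamma>) borel (\<lambda>G. \<Sum>l\<in>I. (G$l$j)\<^sup>2)"
    by (rule distr_distr[symmetric]) (simp_all add: standard_gaussian_matrix_measurable[OF \<Gamma>])
  finally show ?thesis unfolding distr_standard_gaussian_matrix[OF \<Gamma>] .
qed

text \<open>Replaces the means in the definition of \<alpha> by integrals that depend on the degrees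
  of freedom only.\<close>

lemma integral_sqrt_chi_square:
  assumes P: "X \<in> borel_measurable P" "AE \<omega> in P. 0 \<le> X \<omega>"
    and chi: "distr P borel (\<lambda>\<omega>. (X \<omega>)\<^sup>2) = chi_square p"
  shows "(\<integral>\<omega>. X \<omega> \<partial>P) = (\<integral>y. sqrt y \<partial>chi_square p)"
proof -
  note P(1)[measurable]
  have "(\<integral>y. sqrt y \<partial>chi_square p) = (\<integral>\<omega>. sqrt ((X \<omega>)\<^sup>2) \<partial>P)"
    unfolding chi[symmetric] by (rule integral_distr) measurable
  also have "\<dots> = (\<integral>\<omega>. X \<omega> \<partial>P)"
    using P(2) by (intro integral_cong_AE) auto
  finally show ?thesis ..
qed

lemma sqrt_column_le_norm:
  fixes G :: "real^'k^'n"
  shows "sqrt (\<Sum>l\<in>I. (G$l$j)\<^sup>2) \<le> norm G"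
proof -
  have "(\<Sum>l\<in>I. (G$l$j)\<^sup>2) \<le> (\<Sum>l\<in>UNIV. (norm (G$l))\<^sup>2)"
  proof (rule order.trans)
    show "(\<Sum>l\<in>I. (G$l$j)\<^sup>2) \<le> (\<Sum>l\<in>UNIV. (G$l$j)\<^sup>2)" by (rule sum_mono2) auto
    show "(\<Sum>l\<in>UNIV. (G$l$j)\<^sup>2) \<le> (\<Sum>l\<in>UNIV. (norm (G$l))\<^sup>2)"
      by (intro sum_mono) (metis component_le_norm_cart power2_abs power_mono abs_ge_zero)
  qed
  then show ?thesis by (simp add: norm_vec_def L2_set_def)
qed

section \<open>Lower bound for the mean of the support function\<close>

locale gaussian_matrix =
  fixes N :: "'b measure" and \<Gamma> :: "'b \<Rightarrow> real^'k^'n"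
  assumes \<Gamma>: "standard_gaussian_matrix N \<Gamma>" and k_le_n: "CARD('k) \<le> CARD('n)"
begin

abbreviation gauss :: "(real^'k^'n) measure" where "gauss \<equiv> std_gaussian"

sublocale G: prob_space gauss by (rule prob_space_std_gaussian)
sublocale GG: pair_prob_space gauss gauss ..

lemma integrable_norm_gauss: "integrable gauss norm"
  using standard_gaussian_matrix_integrable_norm[OF \<Gamma>] standard_gaussian_matrix_measurable(2)[OF \<Gamma>]
  unfolding distr_standard_gaussian_matrix[OF \<Gamma>, symmetric] by (simp add: integrable_distr_eq)

lemma gauss_invariant:
  fixes U :: "real^'n^'n" and V :: "real^'k^'k"
  assumes "orthogonal_matrix U" "orthogonal_matrix V"
  shows "distr gauss borel (\<lambda>G. U ** G ** V) = gauss"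
  by (intro distr_std_gaussian_orthogonal_transformation orthogonal_transformation_orthogonal_matrix_mult assms)

lemma borel_measurable_matrix_mult_left [measurable]:
  "(\<lambda>G :: real^'k^'n. (U :: real^'n^'n) ** G) \<in> borel_measurable borel"
  using borel_measurable_matrix_mult[of U "mat 1"] by simp

text \<open>Rotation invariance removes \<open>U\<close>: the projection of a Gaussian column onto a
  fixed subspace of dimension \<open>card I\<close> has a mean length independent of the
  subspace.\<close>

lemma integral_column_tail:
  fixes U :: "real^'n^'n"
  assumes U: "orthogonal_matrix U"
  shows "integrable gauss (\<lambda>G. sqrt (\<Sum>l\<in>I. ((U ** G)$l$j)\<^sup>2))"
    and "(\<integral>G. sqrt (\<Sum>l\<in>I. ((U ** G)$l$j)\<^sup>2) \<partial>gauss) = (\<integral>y. sqrt y \<partial>chi_square (card I))"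
proof -
  let ?r = "\<lambda>G :: real^'k^'n. sqrt (\<Sum>l\<in>I. (G$l$j)\<^sup>2)"
  have [measurable]: "?r \<in> borel_measurable borel"
    by measurable
  have int: "integrable gauss ?r"
    by (rule Bochner_Integration.integrable_bound[OF integrable_norm_gauss])
       (use sqrt_column_le_norm in \<open>auto simp: sum_nonneg\<close>)
  have inv: "distr gauss borel (\<lambda>G. U ** G) = gauss"
    using gauss_invariant[OF U orthogonal_matrix_mat_1] by simp
  show "integrable gauss (\<lambda>G. sqrt (\<Sum>l\<in>I. ((U ** G)$l$j)\<^sup>2))"
    by (rule integrable_distr[of "\<lambda>G. U ** G" gauss borel ?r]) (simp_all add: inv int)
  have "(\<integral>y. sqrt y \<partial>chi_square (card I)) = (\<integral>G. ?r G \<partial>gauss)"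
    unfolding chi_square_eq_distr[OF \<Gamma>, where j=j]
    by (rule integral_distr) simp_all
  also have "\<dots> = (\<integral>G. ?r G \<partial>distr gauss borel (\<lambda>G. U ** G))"
    by (simp only: inv)
  also have "\<dots> = (\<integral>G. ?r (U ** G) \<partial>gauss)"
    by (rule integral_distr) measurable
  finally show "(\<integral>G. sqrt (\<Sum>l\<in>I. ((U ** G)$l$j)\<^sup>2) \<partial>gauss) = (\<integral>y. sqrt y \<partial>chi_square (card I))" ..
qed

text \<open>Column \<open>j\<close> is resampled from an independent \<open>H\<close>. Integrating
  over \<open>H\<close> for fixed \<open>G\<close> and \<open>q\<close> adds the same constant for
  every \<open>q\<close>, and only then is the supremum over \<open>q\<close> taken; so no
  measurable choice of a maximizing frame is required.\<close>

lemma integral_sup_inner_frames_insert: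
  fixes C :: "'k set"
  assumes j: "j \<notin> C"
  shows "(\<integral>G. sup_inner (frames C) G \<partial>gauss) + (\<integral>y. sqrt y \<partial>chi_square (CARD('n) - card C))
    \<le> (\<integral>G. sup_inner (frames (insert j C)) G \<partial>gauss)"
proof -
  define \<psi> where "\<psi> = (\<integral>y. sqrt y \<partial>chi_square (CARD('n) - card C))"
  note ne = frames_nonempty[OF k_le_n]
  have int: "integrable gauss (sup_inner (frames D))" for D
    using integrable_norm_gauss by (intro integrable_sup_inner[OF ne norm_frames_le, where g="\<lambda>x. x"]) auto
  let ?F = "\<lambda>(G :: real^'k^'n, H). sup_inner (frames (insert j C)) (replace_column j G H)"
  have [measurable]: "(\<lambda>(G :: real^'k^'n, H). replace_column j G H) \<in> borel_measurable (gauss \<Otimes>\<^sub>M gauss)"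
  proof -
    have "continuous_on UNIV (\<lambda>x :: (real^'k^'n) \<times> (real^'k^'n). if a = j then snd x $ l $ a else fst x $ l $ a)" for l a
      by (cases "a = j") (auto intro!: continuous_intros)
    then have "(\<lambda>x :: (real^'k^'n) \<times> (real^'k^'n). replace_column j (fst x) (snd x)) \<in> borel_measurable borel"
      unfolding replace_column_def
      by (intro borel_measurable_continuous_onI continuous_on_vec_lambda)
    then show ?thesis by (simp add: std_gaussian_pair case_prod_beta)
  qed
  have [measurable]: "sup_inner (frames (insert j C)) \<in> borel_measurable (borel :: (real^'k^'n) measure)"
    by (rule borel_measurable_sup_inner[OF ne norm_frames_le])
  have intF: "integrable (gauss \<Otimes>\<^sub>M gauss) ?F"
  proof -
    have "integrable (distr (gauss \<Otimes>\<^sub>M gauss) borel (\<lambda>(G, H). replace_column j G H)) (sup_inner (frames (insert j C)))"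
      unfolding distr_replace_column by (rule int)
    then show ?thesis by (subst (asm) integrable_distr_eq) (simp_all add: case_prod_beta')
  qed
  obtain s :: "'k \<Rightarrow> 'n" where "inj s"
    using k_le_n card_le_inj[of "UNIV :: 'k set" "UNIV :: 'n set"] by auto
  then have s: "inj_on s C" by (rule inj_on_subset) simp
  have cardI: "card (- s ` C) = CARD('n) - card C"
    using card_image[OF s] by (simp add: card_Diff_subset Compl_eq_Diff_UNIV)
  have inner_bound: "sup_inner (frames C) G + \<psi> \<le> (\<integral>H. ?F (G, H) \<partial>gauss)"
    if G: "integrable gauss (\<lambda>H. ?F (G, H))" for G
  proof -
    have "sup_inner (frames C) G \<le> (\<integral>H. ?F (G, H) \<partial>gauss) - \<psi>"
    proof (rule sup_inner_le[OF ne norm_frames_le])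
      fix q :: "real^'k^'n" assume q: "q \<in> frames C"
      have f0: "coordinate_frame s C \<in> frames C" using coordinate_frame_in_frames[OF s] .
      obtain U :: "real^'n^'n" where U: "orthogonal_matrix U" "U ** coordinate_frame s C = q"
      proof (rule exists_orthogonal_matrix_mult_eq[of "coordinate_frame s C" q])
        show "transpose (coordinate_frame s C) ** coordinate_frame s C = transpose q ** q"
          using q f0 by (simp add: frames_iff_gram)
      qed (use frames_partial_isometry q f0 in blast)+
      have U': "orthogonal_matrix (transpose U)" using U by (simp add: orthogonal_matrix_def)
      let ?r = "\<lambda>H :: real^'k^'n. sqrt (\<Sum>l\<in>-s ` C. ((transpose U ** H)$l$j)\<^sup>2)"
      have "G \<bullet> q + \<psi> = (\<integral>H. G \<bullet> q + ?r H \<partial>gauss)"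
        using integral_column_tail[OF U', where I="-s ` C" and j=j] G.prob_space by (simp add: \<psi>_def cardI)
      also have "\<dots> \<le> (\<integral>H. ?F (G, H) \<partial>gauss)"
        using integral_column_tail(1)[OF U', where I="-s ` C" and j=j] G
          sup_inner_frames_insert_ge[OF k_le_n j s U]
        by (intro integral_mono) auto
      finally show "G \<bullet> q \<le> (\<integral>H. ?F (G, H) \<partial>gauss) - \<psi>" by simp
    qed
    then show ?thesis by simp
  qed
  have "(\<integral>G. sup_inner (frames C) G \<partial>gauss) + \<psi> = (\<integral>G. sup_inner (frames C) G + \<psi> \<partial>gauss)"
    using int G.prob_space by simp
  also have "\<dots> \<le> (\<integral>G. (\<integral>H. ?F (G, H) \<partial>gauss) \<partial>gauss)"
  proof (rule integral_mono_AE)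
    show "integrable gauss (\<lambda>G. \<integral>H. ?F (G, H) \<partial>gauss)" by (rule GG.integrable_fst'[OF intF])
    show "AE G in gauss. sup_inner (frames C) G + \<psi> \<le> (\<integral>H. ?F (G, H) \<partial>gauss)"
      using GG.AE_integrable_fst'[OF intF] by eventually_elim (rule inner_bound)
  qed (use int in simp)
  also have "\<dots> = integral\<^sup>L (gauss \<Otimes>\<^sub>M gauss) ?F"
    by (rule GG.integral_fst'[OF intF])
  also have "\<dots> = integral\<^sup>L (distr (gauss \<Otimes>\<^sub>M gauss) borel (\<lambda>(G, H). replace_column j G H)) (sup_inner (frames (insert j C)))"
    by (subst integral_distr) (simp_all add: case_prod_beta')
  also have "\<dots> = (\<integral>G. sup_inner (frames (insert j C)) G \<partial>gauss)"
    unfolding distr_replace_column ..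
  finally show ?thesis by (simp add: \<psi>_def)
qed

text \<open>The columns in \<open>C\<close> are added one by one; with \<open>m\<close> of them in
  place, the complement has dimension \<open>CARD('n) - m\<close>.\<close>

lemma integral_sup_inner_frames_ge:
  fixes C :: "'k set"
  shows "(\<Sum>m<card C. \<integral>y. sqrt y \<partial>chi_square (CARD('n) - m)) \<le> (\<integral>G. sup_inner (frames C) G \<partial>gauss)"
  using finite[of C]
proof (induction C rule: finite_induct)
  case empty
  have "0 \<in> frames ({} :: 'k set)" by (simp add: frames_def)
  then have "0 \<le> sup_inner (frames {}) G" for G :: "real^'k^'n"
    using inner_le_sup_inner[OF frames_nonempty[OF k_le_n] norm_frames_le, where q=0 and G=G] by simp
  then show ?case by simp
next
  case (insert j C)
  then show ?case using integral_sup_inner_frames_insert[OF insert(2)] by simp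
qed

text \<open>A whole column is at least as long as the absolute value of one entry, whose mean is
  \<open>sqrt (2 / pi)\<close>. This is what makes \<alpha> positive.\<close>

lemma integral_sqrt_chi_square_CARD_pos: "0 < (\<integral>y. sqrt y \<partial>chi_square CARD('n))"
proof -
  obtain i :: 'n and j :: 'k where True by simp
  note [measurable] = standard_gaussian_matrix_measurable[OF \<Gamma>]
  let ?r = "\<lambda>G :: real^'k^'n. sqrt (\<Sum>l\<in>UNIV. (G$l$j)\<^sup>2)"
  have "(\<integral>\<omega>. \<bar>\<Gamma> \<omega> $ i $ j\<bar> \<partial>N) = sqrt (2 / pi)"
    using \<Gamma> integral_std_normal_moment_abs_odd[of 0]
      distributed_integral[of N lborel "\<lambda>\<omega>. \<Gamma> \<omega> $ i $ j" std_normal_density "\<lambda>x. \<bar>x\<bar>"]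
    by (simp add: standard_gaussian_matrix_def)
  moreover have "(\<integral>\<omega>. \<bar>\<Gamma> \<omega> $ i $ j\<bar> \<partial>N) = (\<integral>G. \<bar>G$i$j\<bar> \<partial>gauss)"
    unfolding distr_standard_gaussian_matrix[OF \<Gamma>, symmetric]
    by (rule integral_distr[symmetric]) simp_all
  moreover have "(\<integral>G. \<bar>G$i$j\<bar> \<partial>gauss) \<le> (\<integral>G. ?r G \<partial>gauss)"
  proof (rule integral_mono')
    show "integrable gauss ?r"
      using integral_column_tail(1)[OF orthogonal_matrix_mat_1, where I=UNIV and j=j] by simp
    fix G :: "real^'k^'n"
    have "(G$i$j)\<^sup>2 \<le> (\<Sum>l\<in>UNIV. (G$l$j)\<^sup>2)" by (rule member_le_sum) auto
    then show "\<bar>G$i$j\<bar> \<le> ?r G" by (metis real_sqrt_abs real_sqrt_le_iff)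
  qed (simp add: sum_nonneg)
  moreover have "(\<integral>G. ?r G \<partial>gauss) = (\<integral>y. sqrt y \<partial>chi_square CARD('n))"
    using integral_column_tail(2)[OF orthogonal_matrix_mat_1, where I=UNIV and j=j] by simp
  ultimately show ?thesis by (metis less_le_trans divide_pos_pos pi_gt_zero real_sqrt_gt_zero zero_less_numeral)
qed

end

section \<open>Extended expectations and the theorem\<close>

text \<open>Carries the convex case over to concave functions. Finiteness of the negative part
  excludes \<infinity> - \<infinity>, so changing the sign of the function changes the sign of its
  expectation.\<close>

lemma ext_expectation_uminus_le:
  assumes "ext_expectation_exists N X" "(\<integral>\<^sup>+\<omega>. ennreal (- X \<omega>) \<partial>N) < \<infinity>" "ereal e \<le> ext_expectation N X"
  shows "ext_expectation N (\<lambda>\<omega>. - X \<omega>) \<le> ereal (- e)"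
proof -
  obtain b where b: "(\<integral>\<^sup>+\<omega>. ennreal (- X \<omega>) \<partial>N) = ennreal b" "0 \<le> b"
    using assms(2) by (cases "\<integral>\<^sup>+\<omega>. ennreal (- X \<omega>) \<partial>N") auto
  show ?thesis
  proof (cases "\<integral>\<^sup>+\<omega>. ennreal (X \<omega>) \<partial>N")
    case (real a)
    then show ?thesis using assms(3) b by (simp add: ext_expectation_def enn2ereal_ennreal)
  next
    case top
    then show ?thesis using b by (simp add: ext_expectation_def enn2ereal_ennreal)
  qed
qed

text \<open>An affine minorant of \<open>f\<close> bounds the negative part by an integrable
  function, so the expectation exists and can be infinite only as +\<infinity>.\<close>

lemma convex_on_UNIV_ext_expectation:
  fixes f :: "'a::euclidean_space \<Rightarrow> real"
  assumes f: "convex_on UNIV f" and N: "finite_measure N"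
    and Y: "integrable N (Y :: 'b \<Rightarrow> 'a)"
  shows "(\<integral>\<^sup>+\<omega>. ennreal (- f (Y \<omega>)) \<partial>N) < \<infinity>" "ext_expectation_exists N (\<lambda>\<omega>. f (Y \<omega>))"
    "\<not> integrable N (\<lambda>\<omega>. f (Y \<omega>)) \<Longrightarrow> ext_expectation N (\<lambda>\<omega>. f (Y \<omega>)) = \<infinity>"
    "integrable N (\<lambda>\<omega>. f (Y \<omega>)) \<Longrightarrow> ext_expectation N (\<lambda>\<omega>. f (Y \<omega>)) = ereal (\<integral>\<omega>. f (Y \<omega>) \<partial>N)"
proof -
  interpret finite_measure N by (rule N)
  have meas: "(\<lambda>\<omega>. f (Y \<omega>)) \<in> borel_measurable N"
    using borel_measurable_convex_on_UNIV[OF f] borel_measurable_integrable[OF Y]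
    by (rule measurable_compose_rev)
  obtain s where s: "\<And>x. f 0 + s \<bullet> (x - 0) \<le> f x"
    using convex_on_UNIV_subgradient[OF f, of 0] by blast
  have int: "integrable N (\<lambda>\<omega>. - f 0 - s \<bullet> Y \<omega>)"
    using Y by auto
  have "(\<integral>\<^sup>+\<omega>. ennreal (- f (Y \<omega>)) \<partial>N) \<le> (\<integral>\<^sup>+\<omega>. ennreal (norm (- f 0 - s \<bullet> Y \<omega>)) \<partial>N)"
  proof (intro nn_integral_mono ennreal_leI)
    fix \<omega> show "- f (Y \<omega>) \<le> norm (- f 0 - s \<bullet> Y \<omega>)"
      using s[of "Y \<omega>"] by simp
  qed
  also have "\<dots> < \<infinity>" using int by (simp add: integrable_iff_bounded)
  finally show neg: "(\<integral>\<^sup>+\<omega>. ennreal (- f (Y \<omega>)) \<partial>N) < \<infinity>" .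
  then show "ext_expectation_exists N (\<lambda>\<omega>. f (Y \<omega>))"
    using meas by (simp add: ext_expectation_exists_def)
  show "ext_expectation N (\<lambda>\<omega>. f (Y \<omega>)) = \<infinity>" if "\<not> integrable N (\<lambda>\<omega>. f (Y \<omega>))"
  proof -
    have "(\<integral>\<^sup>+\<omega>. ennreal (f (Y \<omega>)) \<partial>N) = \<infinity>"
      using that neg meas by (auto simp: real_integrable_def)
    moreover obtain b where "(\<integral>\<^sup>+\<omega>. ennreal (- f (Y \<omega>)) \<partial>N) = ennreal b" "0 \<le> b"
      using neg by (cases "\<integral>\<^sup>+\<omega>. ennreal (- f (Y \<omega>)) \<partial>N") auto
    ultimately show ?thesis by (simp add: ext_expectation_def enn2ereal_ennreal)
  qed
  show "ext_expectation N (\<lambda>\<omega>. f (Y \<omega>)) = ereal (\<integral>\<omega>. f (Y \<omega>) \<partial>N)" if I: "integrable N (\<lambda>\<omega>. f (Y \<omega>))"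
  proof -
    have "(\<integral>\<^sup>+\<omega>. ennreal (f (Y \<omega>)) \<partial>N) < \<infinity>"
      using I by (simp add: real_integrable_def less_top)
    then obtain a where a: "(\<integral>\<^sup>+\<omega>. ennreal (f (Y \<omega>)) \<partial>N) = ennreal a" "0 \<le> a"
      by (cases "\<integral>\<^sup>+\<omega>. ennreal (f (Y \<omega>)) \<partial>N") auto
    obtain b where b: "(\<integral>\<^sup>+\<omega>. ennreal (- f (Y \<omega>)) \<partial>N) = ennreal b" "0 \<le> b"
      using neg by (cases "\<integral>\<^sup>+\<omega>. ennreal (- f (Y \<omega>)) \<partial>N") auto
    show ?thesis
      using a b real_lebesgue_integral_def[OF I] by (simp add: ext_expectation_def enn2ereal_ennreal)
  qed
qed

theorem theorem5:
  fixes M :: "'a measure" and Q :: "'a \<Rightarrow> real^'k^'n"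
    and N :: "'b measure" and \<Gamma> :: "'b \<Rightarrow> real^'k^'n"
    and P :: "'c measure" and X :: "nat \<Rightarrow> 'c \<Rightarrow> real"
    and \<alpha> :: real
  assumes "CARD('k) \<le> CARD('n)"
    and "uniform_on_stiefel M Q"
    and "standard_gaussian_matrix N \<Gamma>"
    and "prob_space P"
    and "\<And>i. i \<in> {1..CARD('k)} \<Longrightarrow> X i \<in> borel_measurable P"
    and "\<And>i. i \<in> {1..CARD('k)} \<Longrightarrow> AE \<omega> in P. 0 \<le> X i \<omega>"
    and "\<And>i. i \<in> {1..CARD('k)} \<Longrightarrow>
           distr P borel (\<lambda>\<omega>. (X i \<omega>)\<^sup>2) = chi_square (CARD('n) - i + 1)"
    and "\<alpha> = 1 / real CARD('k) * (\<Sum>i = 1..CARD('k). prob_space.expectation P (X i))"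
  shows "(\<forall>f :: real^'k^'n \<Rightarrow> real. convex_on UNIV f \<longrightarrow>
            integrable M (\<lambda>\<omega>. f (Q \<omega>)) \<and>
            ext_expectation_exists N (\<lambda>\<omega>. f (inverse \<alpha> *\<^sub>R \<Gamma> \<omega>)) \<and>
            ereal (prob_space.expectation M (\<lambda>\<omega>. f (Q \<omega>)))
              \<le> ext_expectation N (\<lambda>\<omega>. f (inverse \<alpha> *\<^sub>R \<Gamma> \<omega>))) \<and>
         (\<forall>g :: real^'k^'n \<Rightarrow> real. concave_on UNIV g \<longrightarrow>
            integrable M (\<lambda>\<omega>. g (Q \<omega>)) \<and>
            ext_expectation_exists N (\<lambda>\<omega>. g (inverse \<alpha> *\<^sub>R \<Gamma> \<omega>)) \<and>
            ereal (prob_space.expectation M (\<lambda>\<omega>. g (Q \<omega>)))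
              \<ge> ext_expectation N (\<lambda>\<omega>. g (inverse \<alpha> *\<^sub>R \<Gamma> \<omega>)))"
proof -
  interpret gaussian_matrix N \<Gamma>
    by (rule gaussian_matrix.intro[OF assms(3,1)])
  interpret N: prob_space N using assms(3) by (simp add: standard_gaussian_matrix_def)
  have Q [measurable]: "Q \<in> borel_measurable M" using assms(2) by (simp add: uniform_on_stiefel_def)
  note [measurable] = standard_gaussian_matrix_measurable[OF assms(3)]
  interpret D: haar_and_invariant "distr M borel Q" gauss
    by standard (use assms(2) gauss_invariant integrable_norm_gauss in \<open>auto simp: uniform_on_stiefel_def\<close>)
  let ?\<psi> = "\<lambda>p. \<integral>y. sqrt y \<partial>chi_square p"
  have EX: "prob_space.expectation P (X i) = ?\<psi> (CARD('n) - (i - 1))" if "i \<in> {1..CARD('k)}" for i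
  proof -
    \<comment> \<open>Subtraction on \<open>nat\<close> truncates; the identity uses 1 \<le>
      \<open>i\<close> \<le> \<open>CARD('n)\<close>.\<close>
    have "CARD('n) - i + 1 = CARD('n) - (i - 1)" using that assms(1) by auto
    then show ?thesis
      using integral_sqrt_chi_square[OF assms(5)[OF that] assms(6)[OF that] assms(7)[OF that]] by simp
  qed
  have "\<alpha> * CARD('k) = (\<Sum>i = 1..CARD('k). ?\<psi> (CARD('n) - (i - 1)))"
    using EX assms(8) by simp
  also have "\<dots> = (\<Sum>m<CARD('k). ?\<psi> (CARD('n) - m))"
    by (rule sum.reindex_bij_witness[of _ "\<lambda>m. Suc m" "\<lambda>i. i - 1"]) auto
  finally have \<alpha>_sum: "\<alpha> * CARD('k) = (\<Sum>m<CARD('k). ?\<psi> (CARD('n) - m))" .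
  then have \<alpha>_le: "\<alpha> * CARD('k) \<le> (\<integral>G. sup_inner stiefel G \<partial>gauss)"
    using integral_sup_inner_frames_ge[of UNIV] by (simp add: frames_UNIV)
  have "0 \<le> ?\<psi> (CARD('n) - m)" if "m < CARD('k)" for m
  proof -
    have "m + 1 \<in> {1..CARD('k)}" using that by simp
    then have "?\<psi> (CARD('n) - m) = (\<integral>\<omega>. X (m + 1) \<omega> \<partial>P)" "AE \<omega> in P. 0 \<le> X (m + 1) \<omega>"
      using EX[of "m + 1"] assms(6)[of "m + 1"] by simp_all
    then show ?thesis by (simp add: integral_nonneg_AE)
  qed
  \<comment> \<open>All summands are nonnegative, so the sum is at least its first term, which is
    positive.\<close>
  then have "?\<psi> (CARD('n) - 0) \<le> \<alpha> * CARD('k)"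
    unfolding \<alpha>_sum by (intro member_le_sum) auto
  then have "0 < \<alpha> * CARD('k)"
    using integral_sqrt_chi_square_CARD_pos by simp
  then have \<alpha>: "0 < \<alpha>" by (simp add: zero_less_mult_iff)
  have \<Gamma>_int: "integrable N (\<lambda>\<omega>. inverse \<alpha> *\<^sub>R \<Gamma> \<omega>)"
    using standard_gaussian_matrix_integrable_norm[OF assms(3)]
    by (simp add: integrable_norm_iff)
  have *: "integrable M (\<lambda>\<omega>. f (Q \<omega>)) \<and> (\<integral>\<^sup>+\<omega>. ennreal (- f (inverse \<alpha> *\<^sub>R \<Gamma> \<omega>)) \<partial>N) < \<infinity> \<and>
      ext_expectation_exists N (\<lambda>\<omega>. f (inverse \<alpha> *\<^sub>R \<Gamma> \<omega>)) \<and>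
      ereal (\<integral>\<omega>. f (Q \<omega>) \<partial>M) \<le> ext_expectation N (\<lambda>\<omega>. f (inverse \<alpha> *\<^sub>R \<Gamma> \<omega>))"
    if f: "convex_on UNIV f" for f :: "real^'k^'n \<Rightarrow> real"
  proof -
    note [measurable] = borel_measurable_convex_on_UNIV[OF f]
    note ext = convex_on_UNIV_ext_expectation[OF f N.finite_measure_axioms \<Gamma>_int]
    have int: "integrable M (\<lambda>\<omega>. f (Q \<omega>))"
      using D.integrable_haar_continuous[OF convex_on_continuous[OF open_UNIV f]]
      by (simp add: integrable_distr_eq)
    have "ereal (\<integral>\<omega>. f (Q \<omega>) \<partial>M) \<le> ext_expectation N (\<lambda>\<omega>. f (inverse \<alpha> *\<^sub>R \<Gamma> \<omega>))"
    \<comment> \<open>Without integrability the right-hand side is \<infinity>, so only the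
      integrable case uses the coupling.\<close>
    proof (cases "integrable N (\<lambda>\<omega>. f (inverse \<alpha> *\<^sub>R \<Gamma> \<omega>))")
      case True
      \<comment> \<open>Rescaling the argument turns \<open>?f (\<alpha> *\<^sub>R q)\<close> into
        \<open>f q\<close>.\<close>
      let ?f = "\<lambda>G. f (inverse \<alpha> *\<^sub>R G)"
      have conv: "convex_on UNIV ?f"
      proof (rule convex_onI)
        fix t :: real and x y :: "real^'k^'n" assume "0 < t" "t < 1"
        then show "?f ((1 - t) *\<^sub>R x + t *\<^sub>R y) \<le> (1 - t) * ?f x + t * ?f y"
          using convex_onD[OF f, of t "inverse \<alpha> *\<^sub>R x" "inverse \<alpha> *\<^sub>R y"]
          by (simp add: scaleR_add_right mult.commute)
      qed simp
      have "integrable (distr N borel \<Gamma>) ?f" using True by (simp add: integrable_distr_eq)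
      then have "(\<integral>q. ?f (\<alpha> *\<^sub>R q) \<partial>distr M borel Q) \<le> (\<integral>G. ?f G \<partial>gauss)"
        by (intro D.convex_domination conv \<alpha> \<alpha>_le) (simp add: distr_standard_gaussian_matrix[OF assms(3)])
      also have "(\<integral>G. ?f G \<partial>gauss) = (\<integral>\<omega>. ?f (\<Gamma> \<omega>) \<partial>N)"
        unfolding distr_standard_gaussian_matrix[OF assms(3), symmetric] by (rule integral_distr) simp_all
      also have "(\<integral>q. ?f (\<alpha> *\<^sub>R q) \<partial>distr M borel Q) = (\<integral>\<omega>. f (Q \<omega>) \<partial>M)"
        using \<alpha> by (subst integral_distr) simp_all
      finally show ?thesis using ext(4)[OF True] by simp
    next
      case False
      then show ?thesis using ext(3) by simp
    qed
    with int ext(1,2) show ?thesis by blast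
  qed
  show ?thesis
  proof (intro conjI allI impI)
    fix g :: "real^'k^'n \<Rightarrow> real" assume "concave_on UNIV g"
    then have "convex_on UNIV (\<lambda>x. - g x)" by (simp add: concave_on_def)
    note g = *[OF this]
    show "integrable M (\<lambda>\<omega>. g (Q \<omega>))" using g by simp
    show "ext_expectation_exists N (\<lambda>\<omega>. g (inverse \<alpha> *\<^sub>R \<Gamma> \<omega>))"
      using g by (auto simp: ext_expectation_exists_def)
    show "ext_expectation N (\<lambda>\<omega>. g (inverse \<alpha> *\<^sub>R \<Gamma> \<omega>)) \<le> ereal (prob_space.expectation M (\<lambda>\<omega>. g (Q \<omega>)))"
      using ext_expectation_uminus_le[of N "\<lambda>\<omega>. - g (inverse \<alpha> *\<^sub>R \<Gamma> \<omega>)" "\<integral>\<omega>. - g (Q \<omega>) \<partial>M"] g by simp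
  qed (use * in blast)+
qed

end
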